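(* Let $\mathbb{K}$ be a field, let $G$ be a simple graph with vertex set $V_G=\{1,\dots,\ell\}$ and edge set $E_G$, and let $\psi\colon V_G\to\mathbb{Z}_{\ge 0}$ be a map. Let $\mathcal{M}_{G,\psi}$ be the associated $\psi$-graphical multiarrangement over $\mathbb{K}$. Then the following conditions are equivalent: 1. $(G,\psi)$ has a weighted elimination ordering. 2. $D(\mathcal{M}_{G,\psi})$ has a basis whose coefficient matrix is lower triangular for some choice of coordinates. 3. $\mathcal{M}_{G,\psi}$ is free.
   Context: A multiarrangement $(\mathcal{A},m)$ is a central hyperplane arrangement $\mathcal{A}$ (a finite set of linear hyperplanes in a finite-dimensional $\mathbb{K}$-vector space $W$) together with a map $m\colon\mathcal{A}\to\mathbb{Z}_{\ge 0}$. For $H\in\mathcal{A}$ let $\alpha_H$ be a linear form with kernel $H$; the defining polynomial is $Q(\mathcal{A},m)=\prod_{H\in\mathcal{A}}\alpha_H^{m(H)}$. Let $S$ be the symmetric algebra of $W^*$ and $\operatorname{Der}(S)$ the $S$-module of $\mathbb{K}$-linear derivations $S\to S$. Put $$D(\mathcal{A},m)=\{\theta\in\operatorname{Der}(S)\mid\theta(\alpha_H)\in\alpha_H^{m(H)}S\text{ for all }H\in\mathcal{A}\}.$$ $(\mathcal{A},m)$ is free if $D(\mathcal{A},m)$ is a free $S$-module. The $\psi$-graphical multiarrangement $\mathcal{M}_{G,\psi}$ is the multiarrangement in the $\ell$-dimensional $\mathbb{K}$-vector space with coordinates $x_1,\dots,x_\ell$ (so $S=\mathbb{K}[x_1,\dots,x_\ell]$)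 given by the defining polynomial $$Q(\mathcal{M}_{G,\psi})=\prod_{\{i,j\}\in E_G}(x_i-x_j)\prod_{1\le i\le\ell}x_i^{\psi(i)}.$$ For a choice of coordinates $(y_1,\dots,y_\ell)$ (an ordered basis of $W^*$), the coefficient matrix of derivations $\theta_1,\dots,\theta_\ell$ is the matrix whose $(i,j)$ entry is $\theta_j(y_i)$. A vertex is simplicial in a graph if the subgraph induced by its neighbors is complete. An ordering $(v_1,\dots,v_\ell)$ of $V_G$ is a perfect elimination ordering if each $v_i$ is simplicial in the subgraph induced by $\{v_1,\dots,v_i\}$; it is a weighted elimination ordering of $(G,\psi)$ if moreover $\psi(v_i)\ge\psi(v_j)$ whenever $i<j$ and $\{v_i,v_j\}\in E_G$. *)

theory Defs
  imports
    "HOL-Analysis.Cartesian_Space"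
    "HOL-Library.Poly_Mapping"
    "HOL-Library.Function_Algebras"
begin

text \<open>
  The index set \<open>{1, ..., l}\<close> is rendered as an arbitrary finite linearly ordered type
  \<open>'n\<close> (every such type is order-isomorphic to \<open>{1, ..., CARD('n)}\<close>). It indexes the
  vertices of the graph, the variables, the positions in a vertex ordering, and the rows
  and columns of coefficient matrices.
\<close>

subsection \<open>Graphs and elimination orderings\<close>

definition simple_graph :: "'n set set \<Rightarrow> bool" where
  "simple_graph E \<longleftrightarrow> (\<forall>e\<in>E. card e = 2)"

definition induced_edges :: "'n set set \<Rightarrow> 'n set \<Rightarrow> 'n set set" where
  "induced_edges E U = {e \<in> E. e \<subseteq> U}"

definition neighbors :: "'n set set \<Rightarrow> 'n \<Rightarrow> 'n set" where
  "neighbors E v = {u. {u, v} \<in> E}"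

definition simplicial :: "'n set set \<Rightarrow> 'n \<Rightarrow> bool" where
  "simplicial E v \<longleftrightarrow>
    (\<forall>u \<in> neighbors E v. \<forall>w \<in> neighbors E v. u \<noteq> w \<longrightarrow> {u, w} \<in> E)"

definition perfect_elimination_ordering ::
    "'n::{finite,linorder} set set \<Rightarrow> ('n \<Rightarrow> 'n) \<Rightarrow> bool" where
  "perfect_elimination_ordering E v \<longleftrightarrow>
    bij v \<and> (\<forall>i. simplicial (induced_edges E (v ` {..i})) (v i))"

definition weighted_elimination_ordering ::
    "'n::{finite,linorder} set set \<Rightarrow> ('n \<Rightarrow> nat) \<Rightarrow> ('n \<Rightarrow> 'n) \<Rightarrow> bool" where
  "weighted_elimination_ordering E \<psi> v \<longleftrightarrow>
    perfect_elimination_ordering E v \<and>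
    (\<forall>i j. i < j \<and> {v i, v j} \<in> E \<longrightarrow> \<psi> (v i) \<ge> \<psi> (v j))"

subsection \<open>The polynomial ring, linear forms and derivations\<close>

type_synonym ('k, 'n) pring = "('n \<Rightarrow>\<^sub>0 nat) \<Rightarrow>\<^sub>0 'k"

definition const :: "'k::field \<Rightarrow> ('k, 'n) pring" where
  "const c = Poly_Mapping.single 0 c"

definition var :: "'n \<Rightarrow> ('k::field, 'n) pring" where
  "var i = Poly_Mapping.single (Poly_Mapping.single i 1) 1"

text \<open>
  The ambient space is \<open>W = 'k ^ 'n\<close>. A linear form on \<open>W\<close> is given by its vector \<open>a\<close> of
  coefficients with respect to \<open>x\<^sub>1, ..., x\<^sub>l\<close>; thus \<open>'k ^ 'n\<close> also serves as
  \<open>W\<^sup>*\<close>, and \<open>linear_form\<close> is its embedding into the polynomial ring.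
\<close>

definition linear_form :: "'k::field ^ 'n::finite \<Rightarrow> ('k, 'n) pring" where
  "linear_form a = (\<Sum>i\<in>UNIV. const (a $ i) * var i)"

definition form_kernel :: "'k::field ^ 'n::finite \<Rightarrow> ('k ^ 'n) set" where
  "form_kernel a = {w. (\<Sum>i\<in>UNIV. a $ i * w $ i) = 0}"

definition derivation :: "(('k::field, 'n) pring \<Rightarrow> ('k, 'n) pring) \<Rightarrow> bool" where
  "derivation \<theta> \<longleftrightarrow>
    (\<forall>p q. \<theta> (p + q) = \<theta> p + \<theta> q) \<and>
    (\<forall>c p. \<theta> (const c * p) = const c * \<theta> p) \<and>
    (\<forall>p q. \<theta> (p * q) = \<theta> p * q + p * \<theta> q)"

definition der_scale ::
    "('k::field, 'n) pring \<Rightarrow> (('k, 'n) pring \<Rightarrow> ('k, 'n) pring)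
      \<Rightarrow> (('k, 'n) pring \<Rightarrow> ('k, 'n) pring)" where
  "der_scale p \<theta> = (\<lambda>q. p * \<theta> q)"

global_interpretation der: module der_scale
  by standard (auto simp: der_scale_def algebra_simps)

subsection \<open>Multiarrangements\<close>

type_synonym ('k, 'n) multiarrangement = "('k ^ 'n) set set \<times> (('k ^ 'n) set \<Rightarrow> nat)"

definition hyperplane :: "('k::field ^ 'n::finite) set \<Rightarrow> bool" where
  "hyperplane H \<longleftrightarrow> (\<exists>a. a \<noteq> 0 \<and> H = form_kernel a)"

definition is_multiarrangement :: "('k::field, 'n::finite) multiarrangement \<Rightarrow> bool" where
  "is_multiarrangement M \<longleftrightarrow> finite (fst M) \<and> (\<forall>H \<in> fst M. hyperplane H)"

text \<open>Defining polynomials are unique only up to the choice of the forms, i.e. up to a unit.\<close>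

definition defining_polynomial ::
    "('k::field, 'n::finite) multiarrangement \<Rightarrow> ('k, 'n) pring \<Rightarrow> bool" where
  "defining_polynomial M Q \<longleftrightarrow>
    (\<exists>\<alpha>. (\<forall>H \<in> fst M. form_kernel (\<alpha> H) = H) \<and>
         Q = (\<Prod>H \<in> fst M. linear_form (\<alpha> H) ^ snd M H))"

text \<open>
  The condition at \<open>H\<close> does not depend on the form chosen to define \<open>H\<close>, since two such
  forms differ by a nonzero scalar; it is imposed for all of them.
\<close>

definition log_der ::
    "('k::field, 'n::finite) multiarrangement \<Rightarrow> (('k, 'n) pring \<Rightarrow> ('k, 'n) pring) set" where
  "log_der M = {\<theta>. derivation \<theta> \<and>
    (\<forall>H \<in> fst M. \<forall>a. form_kernel a = H \<longrightarrow>
       linear_form a ^ snd M H dvd \<theta> (linear_form a))}"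

definition free_multiarrangement :: "('k::field, 'n::finite) multiarrangement \<Rightarrow> bool" where
  "free_multiarrangement M \<longleftrightarrow> (\<exists>B. der.independent B \<and> der.span B = log_der M)"

definition log_der_basis ::
    "('k::field, 'n::finite) multiarrangement
      \<Rightarrow> ('n \<Rightarrow> ('k, 'n) pring \<Rightarrow> ('k, 'n) pring) \<Rightarrow> bool" where
  "log_der_basis M \<theta> \<longleftrightarrow>
    inj \<theta> \<and> der.independent (range \<theta>) \<and> der.span (range \<theta>) = log_der M"

definition coordinates :: "('n::finite \<Rightarrow> 'k::field ^ 'n) \<Rightarrow> bool" where
  "coordinates y \<longleftrightarrow> inj y \<and> vec.independent (range y) \<and> vec.span (range y) = UNIV"

definition coefficient_matrix ::
    "('n::finite \<Rightarrow> 'k::field ^ 'n) \<Rightarrow> ('n \<Rightarrow> ('k, 'n) pring \<Rightarrow> ('k, 'n) pring)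
      \<Rightarrow> ('k, 'n) pring ^ 'n ^ 'n" where
  "coefficient_matrix y \<theta> = (\<chi> i j. \<theta> j (linear_form (y i)))"

definition lower_triangular :: "'a::zero ^ 'n::{finite,linorder} ^ 'n::{finite,linorder} \<Rightarrow> bool" where
  "lower_triangular A \<longleftrightarrow> (\<forall>i j. i < j \<longrightarrow> A $ i $ j = 0)"

subsection \<open>The \<open>\<psi>\<close>-graphical multiarrangement\<close>

definition coord_hyperplane :: "'n::finite \<Rightarrow> ('k::field ^ 'n) set" where
  "coord_hyperplane i = form_kernel (axis i 1)"

definition edge_hyperplane :: "'n::finite \<Rightarrow> 'n \<Rightarrow> ('k::field ^ 'n) set" where
  "edge_hyperplane i j = form_kernel (axis i 1 - axis j 1)"

text \<open>
  All coordinate hyperplanes are included, with multiplicity \<open>\<psi> i\<close>, which may be \<open>0\<close>.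
\<close>

definition psi_graphical ::
    "'n::finite set set \<Rightarrow> ('n \<Rightarrow> nat) \<Rightarrow> ('k::field, 'n) multiarrangement" where
  "psi_graphical E \<psi> =
    ({edge_hyperplane i j | i j. {i, j} \<in> E} \<union> range coord_hyperplane,
     \<lambda>H. if \<exists>i. H = coord_hyperplane i then \<psi> (THE i. H = coord_hyperplane i) else 1)"

subsection \<open>Consistency of the definitions\<close>

lemma subspace_log_der: "der.subspace (log_der M)"
proof (rule der.subspaceI)
  show "0 \<in> log_der M"
    by (simp add: log_der_def derivation_def)
next
  fix \<theta> \<eta> assume "\<theta> \<in> log_der M" "\<eta> \<in> log_der M"
  then show "\<theta> + \<eta> \<in> log_der M"
    by (auto simp: log_der_def derivation_def algebra_simps)
next
  fix p \<theta> assume "\<theta> \<in> log_der M"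
  then show "der_scale p \<theta> \<in> log_der M"
    by (auto simp: log_der_def derivation_def der_scale_def algebra_simps)
qed

lemma axis_in_form_kernel: "axis k 1 \<in> form_kernel a \<longleftrightarrow> a $ k = 0"
proof -
  have "(\<Sum>i\<in>UNIV. a $ i * axis k 1 $ i) = (\<Sum>i\<in>UNIV. if i = k then a $ i else 0)"
    by (rule sum.cong) (auto simp: axis_def)
  then show ?thesis by (simp add: form_kernel_def)
qed

lemma axis_in_coord_hyperplane:
  "axis k (1::'k::field) \<in> coord_hyperplane i \<longleftrightarrow> k \<noteq> i"
  unfolding coord_hyperplane_def axis_in_form_kernel by (simp add: axis_def)

lemma axis_in_edge_hyperplane:
  assumes "i \<noteq> j"
  shows "axis k (1::'k::field) \<in> edge_hyperplane i j \<longleftrightarrow> k \<noteq> i \<and> k \<noteq> j"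
  using assms unfolding edge_hyperplane_def axis_in_form_kernel by (auto simp: axis_def)

lemma edge_hyperplane_commute: "edge_hyperplane i j = edge_hyperplane j i"
  by (auto simp: edge_hyperplane_def form_kernel_def algebra_simps sum_subtractf)

lemma linear_form_axis: "linear_form (axis i 1) = var i"
proof -
  have "linear_form (axis i 1) = (\<Sum>j\<in>UNIV. if j = i then var j else 0)"
    unfolding linear_form_def by (rule sum.cong) (auto simp: axis_def const_def)
  then show ?thesis by simp
qed

lemma linear_form_diff: "linear_form (a - b) = linear_form a - linear_form b"
  by (simp add: linear_form_def const_def single_diff left_diff_distrib sum_subtractf)

definition normal_support :: "('k::field ^ 'n::finite) set \<Rightarrow> 'n set" where
  "normal_support H = {k. axis k 1 \<notin> H}"

lemma normal_support_coord [simp]: "normal_support (coord_hyperplane i) = {i}"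
  by (auto simp: normal_support_def axis_in_coord_hyperplane)

lemma normal_support_edge [simp]: "i \<noteq> j \<Longrightarrow> normal_support (edge_hyperplane i j) = {i, j}"
  by (auto simp: normal_support_def axis_in_edge_hyperplane)

lemma coord_hyperplane_eq_iff [simp]: "coord_hyperplane i = coord_hyperplane j \<longleftrightarrow> i = j"
  by (metis normal_support_coord singleton_inject)

lemma edge_neq_coord:
  assumes "i \<noteq> j"
  shows "edge_hyperplane i j \<noteq> coord_hyperplane k"
proof
  assume "edge_hyperplane i j = coord_hyperplane k"
  then have "{i, j} = {k}"
    using assms by (metis normal_support_coord normal_support_edge)
  with assms show False by auto
qed

lemma snd_psi_graphical_coord [simp]: "snd (psi_graphical E \<psi>) (coord_hyperplane i) = \<psi> i"
  by (auto simp: psi_graphical_def)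

lemma snd_psi_graphical_edge [simp]:
  "i \<noteq> j \<Longrightarrow> snd (psi_graphical E \<psi>) (edge_hyperplane i j) = 1"
  by (auto simp: psi_graphical_def edge_neq_coord)

lemma simple_graph_neq: "simple_graph E \<Longrightarrow> {i, j} \<in> E \<Longrightarrow> i \<noteq> j"
  by (auto simp: simple_graph_def)

lemma is_multiarrangement_psi_graphical:
  assumes "simple_graph E"
  shows "is_multiarrangement (psi_graphical E \<psi> :: ('k::field, 'n::finite) multiarrangement)"
proof -
  have "{edge_hyperplane i j | i j. {i, j} \<in> E} \<subseteq> range (\<lambda>(i, j). edge_hyperplane i j)"
    by auto
  then have "finite {edge_hyperplane i j :: ('k ^ 'n) set | i j. {i, j} \<in> E}"
    by (rule finite_subset) simp
  moreover have "hyperplane (coord_hyperplane i :: ('k ^ 'n) set)" for i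
    unfolding hyperplane_def coord_hyperplane_def by (metis axis_eq_0_iff zero_neq_one)
  moreover have "hyperplane (edge_hyperplane i j :: ('k ^ 'n) set)" if "{i, j} \<in> E" for i j
  proof -
    have "axis i 1 - axis j 1 \<noteq> (0 :: 'k ^ 'n)"
      using simple_graph_neq[OF assms that] by (auto simp: axis_eq_axis)
    then show ?thesis
      unfolding hyperplane_def edge_hyperplane_def by blast
  qed
  ultimately show ?thesis
    unfolding is_multiarrangement_def by (auto simp: psi_graphical_def)
qed

lemma defining_polynomial_psi_graphical:
  fixes E :: "'n::{finite,linorder} set set"
  assumes "simple_graph E"
  shows "defining_polynomial (psi_graphical E \<psi> :: ('k::field, 'n) multiarrangement)
    ((\<Prod>e\<in>E. var (Min e) - var (Max e)) * (\<Prod>i\<in>UNIV. var i ^ \<psi> i))"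
proof -
  let ?M = "psi_graphical E \<psi> :: ('k, 'n) multiarrangement"
  define h where "h e = (edge_hyperplane (Min e) (Max e) :: ('k, 'n) vec set)" for e :: "'n set"
  define \<alpha> :: "('k, 'n) vec set \<Rightarrow> ('k, 'n) vec" where
    "\<alpha> H = (let s = normal_support H in
      if Min s = Max s then axis (Min s) 1 else axis (Min s) 1 - axis (Max s) 1)" for H
  have edge: "Min e \<noteq> Max e \<and> e = {Min e, Max e}" if "e \<in> E" for e
  proof -
    from that assms have "card e = 2" by (auto simp: simple_graph_def)
    then obtain a b where "e = {a, b}" "a \<noteq> b" by (auto simp: card_2_iff)
    then show ?thesis by (auto simp: min_def max_def)
  qed
  have supp_h: "normal_support (h e) = e" if "e \<in> E" for e
    using edge[OF that] by (simp add: h_def)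
  have h: "{edge_hyperplane i j | i j. {i, j} \<in> E} = h ` E"
  proof (intro equalityI subsetI)
    fix H :: "('k, 'n) vec set" assume "H \<in> {edge_hyperplane i j | i j. {i, j} \<in> E}"
    then obtain i j where ij: "{i, j} \<in> E" "H = edge_hyperplane i j" by auto
    then have "H = h {i, j}"
      by (cases "i \<le> j") (auto simp: h_def min_def max_def edge_hyperplane_commute)
    with ij show "H \<in> h ` E" by blast
  next
    fix H assume "H \<in> h ` E"
    then show "H \<in> {edge_hyperplane i j | i j. {i, j} \<in> E}"
      using edge unfolding h_def by (auto, metis)
  qed
  have fst_M: "fst ?M = h ` E \<union> range coord_hyperplane"
    by (simp add: psi_graphical_def h)
  have disj: "h ` E \<inter> range coord_hyperplane = {}"
    unfolding h_def using edge edge_neq_coord by (blast dest: sym)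
  have inj: "inj_on h E"
    using supp_h by (metis inj_onI)
  have \<alpha>_coord: "\<alpha> (coord_hyperplane i) = axis i 1" for i
    by (simp add: \<alpha>_def)
  have \<alpha>_h: "\<alpha> (h e) = axis (Min e) 1 - axis (Max e) 1" if "e \<in> E" for e
    using edge[OF that] supp_h[OF that] by (simp add: \<alpha>_def)
  have mult_h: "snd ?M (h e) = 1" if "e \<in> E" for e
    using edge[OF that] by (simp add: h_def)
  have "form_kernel (\<alpha> H) = H" if "H \<in> fst ?M" for H
    using that unfolding fst_M
    by (auto simp: \<alpha>_h \<alpha>_coord) (auto simp: h_def edge_hyperplane_def coord_hyperplane_def)
  moreover have "(\<Prod>H \<in> fst ?M. linear_form (\<alpha> H) ^ snd ?M H) =
      (\<Prod>e\<in>E. var (Min e) - var (Max e)) * (\<Prod>i\<in>UNIV. var i ^ \<psi> i)"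
  proof -
    have "(\<Prod>H \<in> h ` E. linear_form (\<alpha> H) ^ snd ?M H) = (\<Prod>e\<in>E. var (Min e) - var (Max e))"
      by (simp add: prod.reindex[OF inj] \<alpha>_h mult_h linear_form_diff linear_form_axis)
    moreover have "(\<Prod>H \<in> range coord_hyperplane. linear_form (\<alpha> H) ^ snd ?M H) =
        (\<Prod>i\<in>UNIV. var i ^ \<psi> i)"
      by (subst prod.reindex) (auto simp: inj_on_def \<alpha>_coord linear_form_axis)
    ultimately show ?thesis
      unfolding fst_M by (subst prod.union_disjoint) (auto simp: disj)
  qed
  ultimately show ?thesis
    unfolding defining_polynomial_def by metis
qed

end

theory Submission
  imports Defs "HOL-Analysis.Determinants" "HOL-Computational_Algebra.Factorial_Ring"
begin

text \<open>
  A derivation \<open>\<theta>\<close> is the tuple \<open>f\<^sub>v = \<theta> x\<^sub>v\<close>, and it is logarithmic for the arrangement of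
  \<open>(G, \<psi>)\<close> iff \<open>x\<^sub>v\<close> to the power \<open>\<psi> v\<close> divides \<open>f\<^sub>v\<close> and \<open>x\<^sub>u - x\<^sub>v\<close> divides \<open>f\<^sub>u - f\<^sub>v\<close> for every edge
  (\<open>log_der_iff_splines\<close>). Everything below is about the module of these tuples, the splines.

  From an ordering to a triangular basis. Suppose that a spline is given on the first vertices of a
  weighted elimination ordering, and let \<open>w\<close> be the next vertex. The earlier neighbours \<open>u\<close> of \<open>w\<close> have
  weight at least \<open>\<psi> w\<close>, so that a power of \<open>x\<^sub>u\<close> with exponent \<open>\<psi> w\<close> can be split off from \<open>f\<^sub>u\<close>; they
  form a clique, so that the remaining cofactors can be interpolated in the way of Newton
  (\<open>interpolation\<close>). Hence \<open>f\<close> extends to \<open>w\<close>. Starting at the \<open>k\<close>-th vertex with the product of all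
  forms that a spline vanishing on the earlier vertices must be divisible by there, one obtains for
  every \<open>k\<close> a spline with smallest possible leading entry, and elimination of leading entries shows
  that these splines form a basis (\<open>triangular_splines\<close>, \<open>triangular_basis\<close>).

  From freeness to an ordering. If the module of splines is free, its rank is the number of vertices,
  and the determinant of a basis divides the defining polynomial \<open>Q\<close>; this is the needed half of
  Saito's criterion (\<open>det_spline_basis_dvd\<close>). It excludes two configurations. Both are induced paths
  \<open>p\<^sub>0, ..., p\<^sub>m\<close> with \<open>m \<ge> 2\<close>: in a hole, the two ends have a common neighbour \<open>q\<close> that is
  adjacent to no inner vertex; in a valley, the weight is a constant \<open>c\<close> at the inner vertices and
  larger than \<open>c\<close> at both ends. Put \<open>z = x\<^sub>q\<close> for a hole and \<open>z = 0\<close> for a valley. On the flat where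
  \<open>x = z\<close> at every vertex of the path, the entries of splines satisfy more congruences than the
  order of vanishing of \<open>Q\<close> accounts for: the quotients given by the divisibility conditions at the
  edges of the path and at its two ends obey one linear relation, which closes the path up to a cycle
  through \<open>z\<close>, and this relation forces many of them to vanish on the flat. Therefore the determinant
  vanishes there to a higher order than \<open>Q\<close> and cannot divide it (\<open>determinant_along_path\<close>).

  It remains to see that a weighted graph with neither holes nor valleys has a weighted elimination
  ordering. In every induced subgraph, consider a component of the set of vertices of smallest weight.
  The absence of valleys makes its boundary a clique, and the argument of Dirac for chordal graphs
  then yields a vertex of the component that is simplicial (\<open>simplicial_sink\<close>). This vertex is placed
  last, and one continues with the others.
\<close>

section \<open>Substitutions and derivations of the polynomial ring\<close>

lemma const_0 [simp]: "const 0 = 0"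
  and const_1 [simp]: "const 1 = 1"
  and const_add: "const (a + b) = const a + const b"
  and const_mult: "const (a * b) = const a * const b"
  by (simp_all add: const_def single_add mult_single)

lemma const_mult_single: "const c * Poly_Mapping.single m d = Poly_Mapping.single m (c * d)"
  by (simp add: const_def mult_single)

lemma pring_sum_singles:
  "p = (\<Sum>m\<in>Poly_Mapping.keys p. Poly_Mapping.single m (Poly_Mapping.lookup p m))"
  by (rule poly_mapping_eqI)
    (auto simp: lookup_sum lookup_single when_def not_in_keys_iff_lookup_eq_zero sum.delta)

lemma pring_induct_singles:
  assumes "P 0" "\<And>m c. P (Poly_Mapping.single m c)" "\<And>p q. P p \<Longrightarrow> P q \<Longrightarrow> P (p + q)"
  shows "P (p :: ('k::field, 'n) pring)"
proof -
  have "P (\<Sum>m\<in>A. Poly_Mapping.single m (Poly_Mapping.lookup p m))" if "finite A" for A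
    using that by induction (auto simp: assms)
  then show ?thesis
    by (subst pring_sum_singles) simp
qed

lemma var_power: "var i ^ k = Poly_Mapping.single (Poly_Mapping.single i k) 1"
  by (induction k) (auto simp: var_def mult_single simp flip: single_add)

lemma single_eq_prod_var:
  "Poly_Mapping.single m (c::'k::field)
    = const c * (\<Prod>i\<in>UNIV. var i ^ Poly_Mapping.lookup (m :: 'n::finite \<Rightarrow>\<^sub>0 nat) i)"
proof -
  have "(\<Prod>i\<in>A. var i ^ Poly_Mapping.lookup m i)
      = Poly_Mapping.single (\<Sum>i\<in>A. Poly_Mapping.single i (Poly_Mapping.lookup m i)) (1::'k)"
    if "finite A" for A
    using that by induction (simp_all add: var_power mult_single)
  moreover have "(\<Sum>i\<in>UNIV. Poly_Mapping.single i (Poly_Mapping.lookup m i)) = m"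
    by (rule poly_mapping_eqI) (auto simp: lookup_sum lookup_single when_def)
  ultimately have "(\<Prod>i\<in>UNIV. var i ^ Poly_Mapping.lookup m i) = Poly_Mapping.single m (1::'k)"
    by (metis finite)
  then show ?thesis
    by (simp add: const_mult_single)
qed

lemma pring_induct [case_names const var add mult]:
  assumes "\<And>c. P (const c)" "\<And>i. P (var i)"
    and "\<And>p q. P p \<Longrightarrow> P q \<Longrightarrow> P (p + q)" and "\<And>p q. P p \<Longrightarrow> P q \<Longrightarrow> P (p * q)"
  shows "P (p :: ('k::field, 'n::finite) pring)"
proof (induction p rule: pring_induct_singles)
  case 1
  show ?case using assms(1)[of 0] by simp
next
  case (2 m c)
  have pow: "P (var i ^ k)" for i k
    using assms(1)[of 1] by (induction k) (auto intro: assms)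
  have "P (\<Prod>i\<in>A. var i ^ Poly_Mapping.lookup m i)" if "finite A" for A
    using that
  proof induction
    case empty
    show ?case using assms(1)[of 1] by simp
  next
    case (insert i A)
    then show ?case by (simp add: assms(4) pow)
  qed
  then show ?case
    unfolding single_eq_prod_var by (intro assms) auto
qed (rule assms)

definition linear_extension ::
    "(('n \<Rightarrow>\<^sub>0 nat) \<Rightarrow> ('k, 'n) pring) \<Rightarrow> ('k::field, 'n) pring \<Rightarrow> ('k, 'n) pring" where
  "linear_extension \<phi> p = (\<Sum>m\<in>Poly_Mapping.keys p. const (Poly_Mapping.lookup p m) * \<phi> m)"

lemma linear_extension_add:
  "linear_extension \<phi> (p + q) = linear_extension \<phi> p + linear_extension \<phi> q"
  unfolding linear_extension_def
  by (rule setsum_keys_plus_distrib) (auto simp: const_add algebra_simps)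

lemma linear_extension_0 [simp]: "linear_extension \<phi> 0 = 0"
  by (simp add: linear_extension_def)

lemma linear_extension_single [simp]:
  "linear_extension \<phi> (Poly_Mapping.single m c) = const c * \<phi> m"
  by (simp add: linear_extension_def)

lemma linear_extension_const_mult:
  "linear_extension \<phi> (const c * p) = const c * linear_extension \<phi> p"
  by (induction p rule: pring_induct_singles)
    (simp_all add: const_mult_single const_mult linear_extension_add distrib_left mult.assoc)

text \<open>
  The product rule of \<open>\<phi>\<close> on monomials passes to all polynomials by bilinearity. Taking
  \<open>\<gamma> = \<phi>' = 0\<close> and \<open>\<alpha> = \<beta> = \<phi>\<close> this gives ring homomorphisms; taking \<open>\<alpha> = \<phi>' = \<phi>\<close> and the
  identity of monomials for \<open>\<beta>\<close> and \<open>\<gamma>\<close> it gives derivations.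
\<close>

lemma linear_extension_mult:
  fixes \<phi> \<alpha> \<beta> :: "('n \<Rightarrow>\<^sub>0 nat) \<Rightarrow> ('k::field, 'n) pring"
  assumes "\<And>m n. \<phi> (m + n) = \<alpha> m * \<beta> n + \<gamma> m * \<phi>' n"
  shows "linear_extension \<phi> (p * q) = linear_extension \<alpha> p * linear_extension \<beta> q
    + linear_extension \<gamma> p * linear_extension \<phi>' q"
proof (induction p rule: pring_induct_singles)
  case (2 m c)
  show ?case
  proof (induction q rule: pring_induct_singles)
    case (2 n d)
    show ?case
      by (simp add: mult_single const_mult assms) (simp add: algebra_simps)
  qed (simp_all add: linear_extension_add algebra_simps)
qed (simp_all add: linear_extension_add algebra_simps)

definition subst :: "('n \<Rightarrow> ('k, 'n) pring) \<Rightarrow> ('k::field, 'n::finite) pring \<Rightarrow> ('k, 'n) pring" where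
  "subst f = linear_extension (\<lambda>m. \<Prod>i\<in>UNIV. f i ^ Poly_Mapping.lookup m i)"

lemma subst_add [simp]: "subst f (p + q) = subst f p + subst f q"
  by (simp add: subst_def linear_extension_add)

lemma subst_mult [simp]: "subst f (p * q) = subst f p * subst f q"
proof -
  have zero: "linear_extension (\<lambda>_. 0) q = 0" for q :: "('k::field, 'n::finite) pring"
    by (simp add: linear_extension_def)
  show ?thesis
    unfolding subst_def
    by (subst linear_extension_mult[where \<gamma> = "\<lambda>_. 0" and \<phi>' = "\<lambda>_. 0"])
      (auto simp: lookup_add power_add prod.distrib zero)
qed

lemma subst_const [simp]: "subst f (const c) = const c"
  by (simp add: subst_def const_def)

lemma subst_0 [simp]: "subst f 0 = 0" and subst_1 [simp]: "subst f 1 = 1"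
  using subst_const[of f 0] subst_const[of f 1] by simp_all

lemma subst_var [simp]: "subst f (var i) = f i"
proof -
  have "(\<Prod>j\<in>UNIV. f j ^ Poly_Mapping.lookup (Poly_Mapping.single i 1) j)
      = (\<Prod>j\<in>UNIV. if j = i then f j else 1)"
    by (rule prod.cong) (auto simp: lookup_single)
  then show ?thesis
    by (simp add: subst_def var_def)
qed

lemma subst_uminus [simp]: "subst f (- p) = - subst f p"
  by (metis add.right_inverse add_eq_0_iff subst_0 subst_add)

lemma subst_diff [simp]: "subst f (p - q) = subst f p - subst f q"
  using subst_add[of f p "- q"] by simp

lemma subst_power [simp]: "subst f (p ^ k) = subst f p ^ k"
  by (induction k) auto

lemma subst_sum [simp]: "subst f (sum g A) = (\<Sum>a\<in>A. subst f (g a))"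
  by (induction A rule: infinite_finite_induct) auto

lemma subst_prod [simp]: "subst f (prod g A) = (\<Prod>a\<in>A. subst f (g a))"
  by (induction A rule: infinite_finite_induct) auto

lemma subst_dvd: "p dvd q \<Longrightarrow> subst f p dvd subst f q"
  by (auto elim!: dvdE)

lemma subst_subst: "subst f (subst g p) = subst (\<lambda>i. subst f (g i)) p"
  by (induction p rule: pring_induct) auto

text \<open>
  Modulo \<open>s\<close>, the substitution fixes all variables, and hence everything.
\<close>

lemma dvd_diff_subst:
  assumes "\<And>i. s dvd var i - f i"
  shows "s dvd p - subst f p"
proof (induction p rule: pring_induct)
  case (add p q)
  then show ?case using dvd_add[OF add] by (simp add: algebra_simps)
next
  case (mult p q)
  have "p * q - subst f (p * q) = (p - subst f p) * q + subst f p * (q - subst f q)"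
    by (simp add: algebra_simps)
  with mult show ?case by simp
qed (auto simp: assms)

definition derivation_of ::
    "('n \<Rightarrow> ('k, 'n) pring) \<Rightarrow> ('k::field, 'n::finite) pring \<Rightarrow> ('k, 'n) pring" where
  "derivation_of f = linear_extension (\<lambda>m. \<Sum>i\<in>UNIV.
     f i * of_nat (Poly_Mapping.lookup m i) * var i ^ (Poly_Mapping.lookup m i - 1)
       * (\<Prod>j\<in>- {i}. var j ^ Poly_Mapping.lookup m j))"

lemma power_Leibniz:
  "of_nat (a + b) * (x :: 'a::comm_ring_1) ^ (a + b - 1)
    = of_nat a * x ^ (a - 1) * x ^ b + x ^ a * (of_nat b * x ^ (b - 1))"
  by (cases a; cases b) (auto simp: algebra_simps power_add)

lemma derivation_derivation_of: "derivation (derivation_of f)"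
proof -
  let ?mon = "\<lambda>m. \<Prod>i\<in>UNIV. var i ^ Poly_Mapping.lookup m i :: ('b, 'a) pring"
  let ?d = "\<lambda>m. \<Sum>i\<in>UNIV.
     f i * of_nat (Poly_Mapping.lookup m i) * var i ^ (Poly_Mapping.lookup m i - 1)
       * (\<Prod>j\<in>- {i}. var j ^ Poly_Mapping.lookup m j)"
  have id: "linear_extension ?mon p = p" for p
    by (induction p rule: pring_induct_singles)
      (auto simp: linear_extension_add simp flip: single_eq_prod_var)
  have mon: "?mon m = var i ^ Poly_Mapping.lookup m i * (\<Prod>j\<in>- {i}. var j ^ Poly_Mapping.lookup m j)"
    for i m
    by (subst prod.remove[of UNIV i]) (auto simp: Compl_eq_Diff_UNIV)
  have Leibniz: "?d (m + n) = ?d m * ?mon n + ?mon m * ?d n" for m n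
  proof -
    have "?d (m + n) = (\<Sum>i\<in>UNIV. f i * of_nat (Poly_Mapping.lookup m i)
          * var i ^ (Poly_Mapping.lookup m i - 1) * (\<Prod>j\<in>- {i}. var j ^ Poly_Mapping.lookup m j) * ?mon n
        + ?mon m * (f i * of_nat (Poly_Mapping.lookup n i) * var i ^ (Poly_Mapping.lookup n i - 1)
          * (\<Prod>j\<in>- {i}. var j ^ Poly_Mapping.lookup n j)))"
    proof (rule sum.cong[OF refl])
      fix i
      let ?a = "Poly_Mapping.lookup m i" and ?b = "Poly_Mapping.lookup n i"
      let ?A = "\<Prod>j\<in>- {i}. var j ^ Poly_Mapping.lookup m j :: ('b, 'a) pring"
      let ?B = "\<Prod>j\<in>- {i}. var j ^ Poly_Mapping.lookup n j :: ('b, 'a) pring"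
      have "f i * of_nat (?a + ?b) * var i ^ (?a + ?b - 1) * (?A * ?B)
          = f i * (of_nat (?a + ?b) * var i ^ (?a + ?b - 1)) * (?A * ?B)"
        by (simp only: mult.assoc)
      also have "\<dots> = f i * of_nat ?a * var i ^ (?a - 1) * ?A * (var i ^ ?b * ?B)
          + (var i ^ ?a * ?A) * (f i * of_nat ?b * var i ^ (?b - 1) * ?B)"
        unfolding power_Leibniz by (simp add: algebra_simps)
      finally show "f i * of_nat (Poly_Mapping.lookup (m + n) i) * var i ^ (Poly_Mapping.lookup (m + n) i - 1)
            * (\<Prod>j\<in>- {i}. var j ^ Poly_Mapping.lookup (m + n) j)
          = f i * of_nat ?a * var i ^ (?a - 1) * ?A * ?mon n
            + ?mon m * (f i * of_nat ?b * var i ^ (?b - 1) * ?B)"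
        unfolding mon[of m i] mon[of n i] by (simp add: lookup_add power_add prod.distrib)
    qed
    then show ?thesis
      by (simp add: sum.distrib sum_distrib_left sum_distrib_right)
  qed
  show ?thesis
    unfolding derivation_def
  proof (intro conjI allI)
    fix p q
    show "derivation_of f (p * q) = derivation_of f p * q + p * derivation_of f q"
      unfolding derivation_of_def by (subst linear_extension_mult[where \<alpha> = ?d and \<beta> = ?mon and \<gamma> = ?mon and \<phi>' = ?d, OF Leibniz]) (simp add: id)
  qed (auto simp: derivation_of_def linear_extension_add linear_extension_const_mult)
qed

lemma derivation_of_var [simp]: "derivation_of f (var i) = f i"
proof -
  have "derivation_of f (var i) = (\<Sum>j\<in>UNIV. if j = i then f j else 0)"
    unfolding derivation_of_def var_def linear_extension_single const_1 mult_1
    by (rule sum.cong) (auto simp: lookup_single when_def)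
  then show ?thesis by simp
qed

lemma derivation_add: "derivation \<theta> \<Longrightarrow> \<theta> (p + q) = \<theta> p + \<theta> q"
  and derivation_const_mult: "derivation \<theta> \<Longrightarrow> \<theta> (const c * p) = const c * \<theta> p"
  and derivation_mult: "derivation \<theta> \<Longrightarrow> \<theta> (p * q) = \<theta> p * q + p * \<theta> q"
  by (auto simp: derivation_def)

lemma derivation_diff: "derivation \<theta> \<Longrightarrow> \<theta> (p - q) = \<theta> p - \<theta> q"
  by (metis add_diff_cancel diff_add_cancel derivation_add)

lemma derivation_const: "derivation \<theta> \<Longrightarrow> \<theta> (const c) = 0"
  using derivation_const_mult[of \<theta> c 1] derivation_mult[of \<theta> 1 1] by simp

lemma derivation_eqI:
  fixes \<theta> \<eta> :: "('k::field, 'n::finite) pring \<Rightarrow> ('k, 'n) pring"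
  assumes "derivation \<theta>" "derivation \<eta>" "\<And>i. \<theta> (var i) = \<eta> (var i)"
  shows "\<theta> = \<eta>"
proof
  fix p show "\<theta> p = \<eta> p"
    by (induction p rule: pring_induct)
      (use assms in \<open>simp_all add: derivation_add derivation_mult derivation_const\<close>)
qed

section \<open>Linear forms as primes\<close>

lemma var_neq_0 [simp]: "var i \<noteq> (0 :: ('k::field, 'n) pring)"
  by (metis lookup_single_eq lookup_zero one_neq_zero var_def)

lemma var_eq_iff [simp]: "var i = (var j :: ('k::field, 'n) pring) \<longleftrightarrow> i = j"
proof
  assume "var i = (var j :: ('k, 'n) pring)"
  then have "Poly_Mapping.keys (var i :: ('k, 'n) pring) = Poly_Mapping.keys (var j :: ('k, 'n) pring)"
    by simp
  then have "Poly_Mapping.keys (Poly_Mapping.single i (1::nat)) = Poly_Mapping.keys (Poly_Mapping.single j (1::nat))"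
    by (simp add: var_def)
  then show "i = j" by simp
qed simp

text \<open>
  Linear forms are handled through the substitution that eliminates one variable: the ideal of
  \<open>x\<^sub>i - z\<close> is its kernel. Since its values lie in a domain, \<open>x\<^sub>i - z\<close> is prime.
\<close>

lemma dvd_iff_subst_eq_0:
  assumes "subst (var(i := z)) z = z"
  shows "var i - z dvd p \<longleftrightarrow> subst (var(i := z)) p = 0"
proof
  assume "var i - z dvd p"
  then have "subst (var(i := z)) (var i - z) dvd subst (var(i := z)) p" by (rule subst_dvd)
  with assms show "subst (var(i := z)) p = 0" by simp
next
  assume "subst (var(i := z)) p = 0"
  moreover have "var i - z dvd p - subst (var(i := z)) p"
    by (rule dvd_diff_subst) simp
  ultimately show "var i - z dvd p" by simp
qed

lemma prime_var_diff:
  fixes z :: "('k::field, 'n::{finite,linorder}) pring"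
  assumes "subst (var(i := z)) z = z" "var i \<noteq> z"
  shows "prime_elem (var i - z)"
  unfolding prime_elem_def dvd_iff_subst_eq_0[OF assms(1)] using assms(2) by simp

lemma dvd_edge_iff:
  "var i - var j dvd p \<longleftrightarrow> subst (var(i := var j)) p = 0"
  by (rule dvd_iff_subst_eq_0) simp

lemma dvd_var_iff: "var i dvd p \<longleftrightarrow> subst (var(i := 0)) p = 0"
  using dvd_iff_subst_eq_0[of i 0 p] by simp

lemma prime_var: "prime_elem (var i :: ('k::field, 'n::{finite,linorder}) pring)"
  using prime_var_diff[of i 0] by simp

lemma prime_edge:
  "i \<noteq> j \<Longrightarrow> prime_elem (var i - var j :: ('k::field, 'n::{finite,linorder}) pring)"
  by (rule prime_var_diff) auto

lemma prime_elem_dvd_prod: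
  assumes "prime_elem p" "finite A" "p dvd prod f A"
  shows "\<exists>a\<in>A. p dvd f a"
  using assms(2,3)
proof induction
  case empty
  with assms(1) show ?case by (simp add: prime_elem_def)
next
  case (insert a A)
  then have "p dvd f a \<or> p dvd prod f A"
    using prime_elem_dvd_multD[OF assms(1)] by simp
  with insert.IH show ?case by blast
qed

lemma prod_primes_dvd:
  fixes \<alpha> :: "'i \<Rightarrow> 'a::idom"
  assumes "finite J" "\<And>i. i \<in> J \<Longrightarrow> prime_elem (\<alpha> i)" "\<And>i. i \<in> J \<Longrightarrow> \<alpha> i dvd p"
    and "\<And>i j. i \<in> J \<Longrightarrow> j \<in> J \<Longrightarrow> i \<noteq> j \<Longrightarrow> \<not> \<alpha> i dvd \<alpha> j"
  shows "prod \<alpha> J dvd p"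
  using assms
proof (induction J)
  case (insert i J)
  note prime = insert.prems(1) and ndvd = insert.prems(3) and i = insert.hyps(2)
  from insert obtain r where r: "p = prod \<alpha> J * r" by (auto elim: dvdE)
  have ndvd_prod: "\<not> \<alpha> i dvd prod \<alpha> J"
    using prime_elem_dvd_prod[OF prime insert.hyps(1), of i \<alpha>] ndvd i by (metis insertCI)
  have "\<alpha> i dvd prod \<alpha> J * r" using insert.prems r by auto
  then have "\<alpha> i dvd r"
    using ndvd_prod prime[of i] by (auto simp: prime_elem_dvd_mult_iff)
  with insert.hyps r show ?case by (auto simp: mult.commute intro: mult_dvd_mono)
qed simp

lemma diff_dvd_power_diff: "x - y dvd x ^ n - (y ^ n :: 'a::comm_ring_1)"
proof (induction n)
  case (Suc n)
  have "x ^ Suc n - y ^ Suc n = x * (x ^ n - y ^ n) + (x - y) * y ^ n"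
    by (simp add: algebra_simps)
  with Suc show ?case by simp
qed simp

text \<open>
  Modulo \<open>x\<^sub>i - x\<^sub>j\<close> the two powers agree, and the prime \<open>x\<^sub>i - x\<^sub>j\<close> does not divide them.
\<close>

lemma edge_dvd_cancel_power:
  fixes g g' :: "('k::field, 'n::{finite,linorder}) pring"
  assumes "i \<noteq> j" "var i - var j dvd var i ^ c * g - var j ^ c * g'"
  shows "var i - var j dvd g - g'"
proof -
  have "var i ^ c * (g - g') = (var i ^ c * g - var j ^ c * g') - (var i ^ c - var j ^ c) * g'"
    by (simp add: algebra_simps)
  then have "var i - var j dvd var i ^ c * (g - g')"
    using assms(2) dvd_mult2[OF diff_dvd_power_diff[of "var i" "var j" c], of g'] by (metis dvd_diff)
  moreover have "\<not> var i - var j dvd (var i ^ c :: ('k, 'n) pring)"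
    by (simp add: dvd_edge_iff)
  moreover have "prime_elem (var i - var j :: ('k, 'n) pring)"
    by (rule prime_edge[OF assms(1)])
  ultimately show ?thesis by (auto simp: prime_elem_dvd_mult_iff)
qed

section \<open>Logarithmic derivations as tuples of polynomials\<close>

text \<open>
  The name is taken from the theory of generalised splines on graphs, where a tuple indexed by the
  vertices is required to satisfy a congruence at every edge.
\<close>

definition splines :: "'n set set \<Rightarrow> ('n \<Rightarrow> nat) \<Rightarrow> ('n \<Rightarrow> ('k::field, 'n) pring) set" where
  "splines E \<psi> = {f. (\<forall>i. var i ^ \<psi> i dvd f i) \<and>
     (\<forall>i j. {i, j} \<in> E \<longrightarrow> var i - var j dvd f i - f j)}"

lemma const_mult_dvd_iff:
  assumes "c \<noteq> 0"
  shows "const c * p dvd q \<longleftrightarrow> p dvd q" "p dvd const c * q \<longleftrightarrow> p dvd q"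
proof -
  have 1: "const (inverse c) * (const c * q) = q" for q
    using assms by (simp add: const_mult[symmetric] mult.assoc[symmetric])
  show "const c * p dvd q \<longleftrightarrow> p dvd q"
    by (metis 1 dvd_mult_right dvd_triv_right mult.left_commute mult_dvd_mono dvd_triv_left dvd_trans)
  show "p dvd const c * q \<longleftrightarrow> p dvd q"
    by (metis 1 dvd_mult)
qed

lemma const_power: "const (c ^ k) = const c ^ k"
  by (induction k) (auto simp: const_mult)

lemma linear_form_coord:
  assumes "form_kernel a = (coord_hyperplane i :: ('k::field ^ 'n::finite) set)"
  shows "a $ i \<noteq> 0" "linear_form a = const (a $ i) * var i"
proof -
  have supp: "a $ k = 0 \<longleftrightarrow> k \<noteq> i" for k
    using axis_in_form_kernel[of k a] axis_in_coord_hyperplane[where 'k = 'k and k = k and i = i] assms by simp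
  then show "a $ i \<noteq> 0" by simp
  have supp': "a $ k = 0" if "k \<noteq> i" for k using supp that by blast
  have 1: "const (a $ k) * var k = (if k = i then const (a $ i) * var i else 0)" for k
    by (cases "k = i") (simp_all add: supp')
  show "linear_form a = const (a $ i) * var i"
    unfolding linear_form_def by (subst sum.cong[OF refl 1]) simp_all
qed

lemma linear_form_edge:
  assumes "form_kernel a = (edge_hyperplane i j :: ('k::field ^ 'n::finite) set)" "i \<noteq> j"
  shows "a $ i \<noteq> 0" "linear_form a = const (a $ i) * (var i - var j)"
proof -
  have supp: "a $ k = 0 \<longleftrightarrow> k \<noteq> i \<and> k \<noteq> j" for k
    using axis_in_form_kernel[of k a] axis_in_edge_hyperplane[where 'k = 'k and k = k and i = i and j = j] assms by simp
  then show "a $ i \<noteq> 0" by simp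
  have sum_if: "(\<Sum>k\<in>UNIV. (b :: 'n \<Rightarrow> 'k) k * (axis i 1 + axis j 1) $ k) = b i + b j" for b
  proof -
    have "(\<Sum>k\<in>UNIV. b k * (axis i 1 + axis j 1) $ k)
        = (\<Sum>k\<in>UNIV. (if k = i then b k else 0) + (if k = j then b k else 0))"
      by (intro sum.cong) (auto simp: axis_def \<open>i \<noteq> j\<close>)
    then show ?thesis by (simp add: sum.distrib)
  qed
  have "axis i 1 + axis j 1 \<in> (edge_hyperplane i j :: ('k ^ 'n) set)"
    unfolding edge_hyperplane_def form_kernel_def mem_Collect_eq sum_if
    using \<open>i \<noteq> j\<close> by (simp add: axis_def)
  then have "a $ i + a $ j = 0"
    unfolding assms(1)[symmetric] form_kernel_def mem_Collect_eq sum_if .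
  then have aj: "a $ j = - a $ i" by (simp add: eq_neg_iff_add_eq_0 add.commute)
  have supp': "a $ k = 0" if "k \<noteq> i" "k \<noteq> j" for k using supp that by blast
  have 1: "const (a $ k) * var k = (if k = i then const (a $ i) * var i else 0)
      + (if k = j then const (a $ j) * var j else 0)" for k
    by (cases "k = i"; cases "k = j") (use \<open>i \<noteq> j\<close> in \<open>simp_all add: supp'\<close>)
  have 2: "linear_form a = const (a $ i) * var i + const (a $ j) * var j"
    unfolding linear_form_def by (subst sum.cong[OF refl 1]) (simp_all add: sum.distrib)
  have 3: "const (a $ j) = - const (a $ i)"
    unfolding aj const_def single_uminus by (rule refl)
  show "linear_form a = const (a $ i) * (var i - var j)"
    unfolding 2 3 right_diff_distrib by simp
qed

lemma log_der_iff_splines: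
  fixes E :: "'n::finite set set"
  assumes "simple_graph E"
  shows "\<theta> \<in> log_der (psi_graphical E \<psi> :: ('k::field, 'n) multiarrangement)
    \<longleftrightarrow> derivation \<theta> \<and> (\<lambda>i. \<theta> (var i)) \<in> splines E \<psi>"
proof (cases "derivation \<theta>")
  case der: True
  let ?M = "psi_graphical E \<psi> :: ('k, 'n) multiarrangement"
  define ok where "ok H \<longleftrightarrow> (\<forall>a. form_kernel a = H \<longrightarrow> linear_form a ^ snd ?M H dvd \<theta> (linear_form a))"
    for H :: "('k ^ 'n) set"
  have coord: "ok (coord_hyperplane i) \<longleftrightarrow> var i ^ \<psi> i dvd \<theta> (var i)" for i
  proof -
    have *: "linear_form a ^ \<psi> i dvd \<theta> (linear_form a) \<longleftrightarrow> var i ^ \<psi> i dvd \<theta> (var i)"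
      if "form_kernel a = (coord_hyperplane i :: ('k ^ 'n) set)" for a
      using linear_form_coord[OF that]
      by (simp add: derivation_const_mult[OF der] const_mult_dvd_iff power_mult_distrib flip: const_power)
    have "form_kernel (axis i 1) = (coord_hyperplane i :: ('k ^ 'n) set)"
      by (simp add: coord_hyperplane_def)
    with * show ?thesis by (auto simp: ok_def)
  qed
  have edge: "ok (edge_hyperplane i j) \<longleftrightarrow> var i - var j dvd \<theta> (var i) - \<theta> (var j)" if "{i, j} \<in> E" for i j
  proof -
    have "i \<noteq> j" using simple_graph_neq[OF assms that] .
    have *: "linear_form a dvd \<theta> (linear_form a) \<longleftrightarrow> var i - var j dvd \<theta> (var i) - \<theta> (var j)"
      if "form_kernel a = (edge_hyperplane i j :: ('k ^ 'n) set)" for a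
      using linear_form_edge[OF that \<open>i \<noteq> j\<close>]
      by (simp add: derivation_const_mult[OF der] const_mult_dvd_iff derivation_diff[OF der])
    have "form_kernel (axis i 1 - axis j 1) = (edge_hyperplane i j :: ('k ^ 'n) set)"
      by (simp add: edge_hyperplane_def)
    with * show ?thesis by (auto simp: ok_def \<open>i \<noteq> j\<close>)
  qed
  have "\<theta> \<in> log_der ?M \<longleftrightarrow> (\<forall>H \<in> fst ?M. ok H)"
    by (simp add: log_der_def der ok_def)
  also have "\<dots> \<longleftrightarrow> (\<forall>i j. {i, j} \<in> E \<longrightarrow> ok (edge_hyperplane i j)) \<and> (\<forall>i. ok (coord_hyperplane i))"
    unfolding psi_graphical_def fst_conv by blast
  finally show ?thesis
    using edge by (auto simp: coord splines_def der)
qed (simp add: log_der_def)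

lemma splines_diff:
  assumes "f \<in> splines E \<psi>" "g \<in> splines E \<psi>"
  shows "(\<lambda>i. f i - g i) \<in> splines E \<psi>"
proof -
  have diff: "f i - g i - (f j - g j) = (f i - f j) - (g i - g j)" for i j
    by simp
  show ?thesis
    using assms unfolding splines_def mem_Collect_eq diff by (blast intro: dvd_diff)
qed

lemma der_sum_apply: "(\<Sum>b\<in>A. der_scale (u b) (\<theta> b)) p = (\<Sum>b\<in>A. u b * \<theta> b p)"
  by (induction A rule: infinite_finite_induct) (auto simp: der_scale_def)

lemma log_der_derivation: "\<theta> \<in> log_der M \<Longrightarrow> derivation \<theta>"
  by (simp add: log_der_def)

section \<open>A triangular basis from a weighted elimination ordering\<close>

text \<open>
  Newton interpolation: if \<open>h\<close> is correct at the nodes in \<open>N\<close>, then for a further node \<open>u\<close> it is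
  corrected by a multiple of the product of all \<open>x\<^sub>w - x\<^sub>u'\<close> with \<open>u' \<in> N\<close>. The coefficient needed is
  \<open>g u - h\<close> divided by that product, both taken at \<open>x\<^sub>w = x\<^sub>u\<close>; the division is exact because every
  \<open>x\<^sub>u - x\<^sub>u'\<close> divides \<open>g u - g u'\<close>, so that the nodes have to form a clique.
\<close>

lemma interpolation:
  fixes g :: "'n \<Rightarrow> ('k::field, 'n::{finite,linorder}) pring"
  assumes "w \<notin> N" "\<And>u u'. u \<in> N \<Longrightarrow> u' \<in> N \<Longrightarrow> u \<noteq> u' \<Longrightarrow> var u - var u' dvd g u - g u'"
  shows "\<exists>h. \<forall>u\<in>N. var w - var u dvd h - g u"
proof -
  have "finite N" by simp
  then show ?thesis using assms
  proof induction
    case (insert u N)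
    from insert.IH insert.prems obtain h where h: "\<And>u'. u' \<in> N \<Longrightarrow> var w - var u' dvd h - g u'"
      by auto
    let ?\<sigma> = "subst (var(w := var u)) :: ('k, 'n) pring \<Rightarrow> _"
    have idem: "?\<sigma> (?\<sigma> p) = ?\<sigma> p" for p
      unfolding subst_subst by (rule arg_cong[where f = "\<lambda>f. subst f p"]) (use insert.prems in auto)
    let ?Q = "\<lambda>x. \<Prod>u'\<in>N. x - var u' :: ('k, 'n) pring"
    have \<sigma>Q: "?\<sigma> (?Q (var w)) = ?Q (var u)" "?\<sigma> (?Q (var u)) = ?Q (var u)"
      using insert.prems by (auto intro!: prod.cong)
    have "?Q (var u) dvd ?\<sigma> (h - g u)"
    proof (rule prod_primes_dvd)
      fix u' assume u': "u' \<in> N"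
      with insert.hyps insert.prems have ne: "u' \<noteq> u" "u' \<noteq> w" "u \<noteq> w" by auto
      then show "prime_elem (var u - var u' :: ('k, 'n) pring)"
        by (intro prime_edge) auto
      have "?\<sigma> (var w - var u') dvd ?\<sigma> (h - g u')" "?\<sigma> (var u' - var u) dvd ?\<sigma> (g u' - g u)"
        using h[OF u'] insert.prems(2)[of u' u] u' ne by (auto intro!: subst_dvd simp del: subst_diff)
      then have "var u - var u' dvd ?\<sigma> (h - g u')" "var u' - var u dvd ?\<sigma> (g u' - g u)"
        using ne by simp_all
      then have "var u - var u' dvd ?\<sigma> (h - g u') + ?\<sigma> (g u' - g u)"
        by (metis dvd_add minus_diff_eq minus_dvd_iff)
      then show "var u - var u' dvd ?\<sigma> (h - g u)"
        by (simp flip: subst_add subst_diff)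
    next
      fix a b assume "a \<in> N" "b \<in> N" "a \<noteq> b"
      with insert.hyps show "\<not> var u - var a dvd (var u - var b :: ('k, 'n) pring)"
        by (auto simp: dvd_edge_iff)
    qed simp
    then obtain c where "?\<sigma> (h - g u) = ?Q (var u) * c" ..
    then have "?\<sigma> (?\<sigma> (h - g u)) = ?\<sigma> (?Q (var u)) * ?\<sigma> c"
      by (metis subst_mult)
    then have c: "?\<sigma> (h - g u) = ?Q (var u) * ?\<sigma> c"
      unfolding idem \<sigma>Q .
    define h' where "h' = h - c * ?Q (var w)"
    have "?\<sigma> (h' - g u) = ?\<sigma> (h - g u) - ?\<sigma> c * ?\<sigma> (?Q (var w))"
      unfolding h'_def subst_diff subst_mult by (simp add: algebra_simps)
    then have "var w - var u dvd h' - g u"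
      unfolding dvd_edge_iff \<sigma>Q c by simp
    moreover have "var w - var u' dvd h' - g u'" if "u' \<in> N" for u'
    proof -
      have "var w - var u' dvd ?Q (var w)"
        using that by (intro dvd_prodI) auto
      from dvd_diff[OF h[OF that] dvd_mult[OF this]]
      have "var w - var u' dvd (h - g u') - c * ?Q (var w)" .
      moreover have "(h - g u') - c * ?Q (var w) = h' - g u'"
        by (simp add: h'_def)
      ultimately show ?thesis by metis
    qed
    ultimately show ?case by blast
  qed simp
qed

text \<open>
  The value at a new vertex \<open>w\<close> of weight \<open>c\<close> with neighbours \<open>N\<close>. It is \<open>x\<^sub>w\<close> to the power \<open>c\<close> times an
  interpolant of the quotients of \<open>f u\<close> by \<open>x\<^sub>u\<close> to the power \<open>c\<close>, and these quotients exist
  because \<open>w\<close> is no heavier than its neighbours.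
\<close>

lemma extend_spline:
  fixes f :: "'n \<Rightarrow> ('k::field, 'n::{finite,linorder}) pring"
  assumes "w \<notin> N" "\<And>u u'. u \<in> N \<Longrightarrow> u' \<in> N \<Longrightarrow> u \<noteq> u' \<Longrightarrow> var u - var u' dvd f u - f u'"
    and "\<And>u. u \<in> N \<Longrightarrow> var u ^ c dvd f u"
  shows "\<exists>r. var w ^ c dvd r \<and> (\<forall>u\<in>N. var w - var u dvd r - f u)"
proof -
  from assms(3) have "\<exists>g. \<forall>u\<in>N. f u = var u ^ c * g u"
    by (intro bchoice) (auto elim: dvdE)
  then obtain g where g: "\<And>u. u \<in> N \<Longrightarrow> f u = var u ^ c * g u" by auto
  have "var u - var u' dvd g u - g u'" if u: "u \<in> N" "u' \<in> N" "u \<noteq> u'" for u u'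
  proof -
    have "var u - var u' dvd var u ^ c * g u - var u' ^ c * g u'"
      using assms(2)[OF u] u(1,2) by (simp add: g)
    then show ?thesis by (rule edge_dvd_cancel_power[OF u(3)])
  qed
  then obtain h where h: "\<And>u. u \<in> N \<Longrightarrow> var w - var u dvd h - g u"
    using interpolation[OF assms(1), of g] by blast
  have "var w - var u dvd var w ^ c * h - f u" if u: "u \<in> N" for u
  proof -
    have "var w ^ c * h - f u = var w ^ c * (h - g u) + (var w ^ c - var u ^ c) * g u"
      using u by (simp add: g algebra_simps)
    then show ?thesis
      using h[OF u] diff_dvd_power_diff by (metis dvd_add dvd_mult dvd_mult2)
  qed
  then show ?thesis by (intro exI[of _ "var w ^ c * h"]) auto
qed

lemma earlier_neighbors:
  assumes "simple_graph E" "weighted_elimination_ordering E \<psi> v"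
  defines "N \<equiv> \<lambda>i. {u \<in> v ` {..<i}. {u, v i} \<in> E}"
  shows "v i \<notin> N i" "u \<in> N i \<Longrightarrow> u' \<in> N i \<Longrightarrow> u \<noteq> u' \<Longrightarrow> {u, u'} \<in> E"
    "u \<in> N i \<Longrightarrow> \<psi> (v i) \<le> \<psi> u"
proof -
  have bij: "bij v" and simp: "simplicial (induced_edges E (v ` {..i})) (v i)"
    and weight: "\<And>i j. i < j \<Longrightarrow> {v i, v j} \<in> E \<Longrightarrow> \<psi> (v j) \<le> \<psi> (v i)"
    using assms(2) by (auto simp: weighted_elimination_ordering_def perfect_elimination_ordering_def)
  show "v i \<notin> N i"
    using bij by (auto simp: N_def bij_def inj_eq)
  have nbr: "u \<in> neighbors (induced_edges E (v ` {..i})) (v i)" if "u \<in> N i" for u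
    using that by (auto simp: N_def neighbors_def induced_edges_def)
  show "{u, u'} \<in> E" if "u \<in> N i" "u' \<in> N i" "u \<noteq> u'"
    using simp nbr[OF that(1)] nbr[OF that(2)] that(3)
    by (auto simp: simplicial_def induced_edges_def)
  show "\<psi> (v i) \<le> \<psi> u" if "u \<in> N i"
    using that weight by (auto simp: N_def)
qed

text \<open>
  A spline that vanishes before position \<open>k\<close> is divisible at \<open>v k\<close> by the power of the variable and
  by \<open>x\<^sub>v - x\<^sub>u\<close> for all earlier neighbours \<open>u\<close>, hence by the product of these pairwise coprime forms.
  This product is attained: extend it, together with zeros before \<open>k\<close>, one vertex at a time.
\<close>

lemma triangular_splines:
  fixes E :: "'n::{finite,linorder} set set"
  assumes "simple_graph E" "weighted_elimination_ordering E \<psi> v"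
  shows "\<exists>f :: 'n \<Rightarrow> ('k::field, 'n) pring. f \<in> splines E \<psi> \<and> (\<forall>i<k. f (v i) = 0) \<and> f (v k) \<noteq> 0 \<and>
    (\<forall>g\<in>splines E \<psi>. (\<forall>i<k. g (v i) = 0) \<longrightarrow> f (v k) dvd g (v k))"
proof -
  define N where "N i = {u \<in> v ` {..<i}. {u, v i} \<in> E}" for i
  note N = earlier_neighbors[OF assms, folded N_def]
  have bij: "bij v"
    using assms(2) by (auto simp: weighted_elimination_ordering_def perfect_elimination_ordering_def)
  then have inj: "v i = v j \<longleftrightarrow> i = j" for i j
    by (auto simp: bij_def inj_eq)
  define \<delta> :: "('k, 'n) pring" where
    "\<delta> = var (v k) ^ \<psi> (v k) * (\<Prod>u\<in>N k. var (v k) - var u)"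
  have Nk: "u \<noteq> v k" if "u \<in> N k" for u
    using that N(1) by auto
  have "\<exists>f. (\<forall>i\<in>A. var (v i) ^ \<psi> (v i) dvd f (v i)) \<and>
      (\<forall>i\<in>A. \<forall>j\<in>A. {v i, v j} \<in> E \<longrightarrow> var (v i) - var (v j) dvd f (v i) - f (v j)) \<and>
      (\<forall>i\<in>A. i < k \<longrightarrow> f (v i) = 0) \<and> (k \<in> A \<longrightarrow> f (v k) = \<delta>)"
    if "finite A" "\<forall>i\<in>A. {..<i} \<subseteq> A" for A
    using that
  proof (induction A rule: finite_linorder_max_induct)
    case (insert b A)
    from insert.prems insert.hyps(2) have A: "A = {..<b}" by auto
    have down: "\<forall>i\<in>A. {..<i} \<subseteq> A"
      unfolding A by auto
    from insert.IH[OF down] obtain f where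
      "\<forall>i\<in>A. var (v i) ^ \<psi> (v i) dvd f (v i)"
      "\<forall>i\<in>A. \<forall>j\<in>A. {v i, v j} \<in> E \<longrightarrow> var (v i) - var (v j) dvd f (v i) - f (v j)"
      "\<forall>i\<in>A. i < k \<longrightarrow> f (v i) = 0" "k \<in> A \<longrightarrow> f (v k) = \<delta>"
      by blast
    then have f: "\<And>i. i < b \<Longrightarrow> var (v i) ^ \<psi> (v i) dvd f (v i)"
      "\<And>i j. i < b \<Longrightarrow> j < b \<Longrightarrow> {v i, v j} \<in> E \<Longrightarrow> var (v i) - var (v j) dvd f (v i) - f (v j)"
      "\<And>i. i < b \<Longrightarrow> i < k \<Longrightarrow> f (v i) = 0" "k < b \<Longrightarrow> f (v k) = \<delta>"
      by (auto simp: A)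
    have "\<exists>r. var (v b) ^ \<psi> (v b) dvd r \<and> (\<forall>u\<in>N b. var (v b) - var u dvd r - f u) \<and>
        (b < k \<longrightarrow> r = 0) \<and> (b = k \<longrightarrow> r = \<delta>)"
    proof (cases b k rule: linorder_cases)
      case less
      then have "f u = 0" if "u \<in> N b" for u
        using that f(3) by (auto simp: N_def)
      with less show ?thesis by (intro exI[of _ 0]) auto
    next
      case equal
      then have "f u = 0" if "u \<in> N b" for u
        using that f(3) by (auto simp: N_def)
      moreover have "var (v k) - var u dvd \<delta>" if "u \<in> N k" for u
        unfolding \<delta>_def by (intro dvd_mult dvd_prodI[OF finite that])
      moreover have "var (v k) ^ \<psi> (v k) dvd \<delta>"
        by (simp add: \<delta>_def)
      ultimately show ?thesis
        using equal by (intro exI[of _ \<delta>]) simp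
    next
      case greater
      have "\<exists>r. var (v b) ^ \<psi> (v b) dvd r \<and> (\<forall>u\<in>N b. var (v b) - var u dvd r - f u)"
      proof (rule extend_spline)
        fix u assume u: "u \<in> N b"
        then obtain i where i: "u = v i" "i < b" by (auto simp: N_def)
        show "var u ^ \<psi> (v b) dvd f u"
          using f(1)[OF i(2)] N(3)[OF u] i(1) by (auto intro: power_le_dvd)
        fix u' assume u': "u' \<in> N b" "u \<noteq> u'"
        then obtain j where j: "u' = v j" "j < b" by (auto simp: N_def)
        show "var u - var u' dvd f u - f u'"
          using f(2)[OF i(2) j(2)] N(2)[OF u u'] i(1) j(1) by auto
      qed (rule N(1))
      with greater show ?thesis by auto
    qed
    then obtain r where r: "var (v b) ^ \<psi> (v b) dvd r" "\<And>u. u \<in> N b \<Longrightarrow> var (v b) - var u dvd r - f u"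
      "b < k \<Longrightarrow> r = 0" "b = k \<Longrightarrow> r = \<delta>" by auto
    have new: "var (v b) - var (v j) dvd r - f (v j)" "var (v j) - var (v b) dvd f (v j) - r"
      if "j < b" "{v j, v b} \<in> E" for j
    proof -
      show *: "var (v b) - var (v j) dvd r - f (v j)"
        using that r(2)[of "v j"] by (auto simp: N_def)
      show "var (v j) - var (v b) dvd f (v j) - r"
        using * by (metis dvd_minus_iff minus_diff_eq minus_dvd_iff)
    qed
    have loop: "{v b, v b} \<notin> E"
      using simple_graph_neq[OF assms(1)] by blast
    show ?case
    proof (intro exI[of _ "f(v b := r)"] conjI ballI impI)
      fix i j assume ij: "i \<in> insert b A" "j \<in> insert b A" "{v i, v j} \<in> E"
      then consider "i < b" "j < b" | "i = b" "j < b" | "i < b" "j = b"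
        using loop by (auto simp: A)
      then show "var (v i) - var (v j) dvd (f(v b := r)) (v i) - (f(v b := r)) (v j)"
      proof cases
        case 1
        with f(2) ij(3) show ?thesis by (auto simp: inj)
      next
        case 2
        with new(1)[of j] ij(3) show ?thesis by (auto simp: inj insert_commute)
      next
        case 3
        with new(2)[of i] ij(3) show ?thesis by (auto simp: inj)
      qed
    qed (use r f in \<open>auto simp: A inj\<close>)
  qed simp
  from this[of UNIV] obtain f where f: "\<And>i. var (v i) ^ \<psi> (v i) dvd f (v i)"
      "\<And>i j. {v i, v j} \<in> E \<Longrightarrow> var (v i) - var (v j) dvd f (v i) - f (v j)"
      "\<And>i. i < k \<Longrightarrow> f (v i) = 0" "f (v k) = \<delta>"
    by auto
  have surj: "\<exists>i. u = v i" for u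
    using bij by (auto simp: bij_def)
  have "var i ^ \<psi> i dvd f i" for i
    using f(1) surj[of i] by auto
  moreover have "var i - var j dvd f i - f j" if "{i, j} \<in> E" for i j
    using f(2) surj[of i] surj[of j] that by auto
  ultimately have "f \<in> splines E \<psi>"
    by (simp add: splines_def)
  moreover have "\<delta> \<noteq> 0"
    using Nk by (auto simp: \<delta>_def)
  moreover have "\<delta> dvd g (v k)" if g: "g \<in> splines E \<psi>" "\<And>i. i < k \<Longrightarrow> g (v i) = 0" for g
  proof -
    have "var (v k) ^ \<psi> (v k) dvd g (v k)"
      using g(1) by (simp add: splines_def)
    then obtain r where r: "g (v k) = var (v k) ^ \<psi> (v k) * r" ..
    have "(\<Prod>u\<in>N k. var (v k) - var u) dvd r"
    proof (rule prod_primes_dvd)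
      fix u assume u: "u \<in> N k"
      with Nk show prime: "prime_elem (var (v k) - var u :: ('k, 'n) pring)"
        by (intro prime_edge) auto
      have "var (v k) - var u dvd g (v k) - g u"
        using g(1) u by (auto simp: splines_def N_def insert_commute)
      moreover have "g u = 0" using g(2) u by (auto simp: N_def)
      moreover have "\<not> var (v k) - var u dvd var (v k) ^ \<psi> (v k)"
        by (simp add: dvd_edge_iff)
      ultimately show "var (v k) - var u dvd r"
        using prime by (auto simp: r prime_elem_dvd_mult_iff)
    next
      fix a b assume "a \<in> N k" "b \<in> N k" "a \<noteq> b"
      with Nk show "\<not> var (v k) - var a dvd (var (v k) - var b :: ('k, 'n) pring)"
        by (auto simp: dvd_edge_iff)
    qed simp
    then show ?thesis by (simp add: \<delta>_def r mult_dvd_mono)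
  qed
  ultimately show ?thesis
    using f(3,4) by blast
qed

lemma splines_sum:
  assumes "\<And>k. k \<in> A \<Longrightarrow> f k \<in> splines E \<psi>"
  shows "(\<lambda>i. \<Sum>k\<in>A. c k * f k i) \<in> splines E \<psi>"
  using assms unfolding splines_def
  by (auto intro!: dvd_sum dvd_mult simp flip: sum_subtractf right_diff_distrib)

lemma triangular_basis:
  fixes E :: "'n::{finite,linorder} set set"
  assumes "simple_graph E" "weighted_elimination_ordering E \<psi> v"
  shows "\<exists>\<theta>. log_der_basis (psi_graphical E \<psi> :: ('k::field, 'n) multiarrangement) \<theta> \<and>
    lower_triangular (coefficient_matrix (\<lambda>i. axis (v i) 1) \<theta>)"
proof -
  let ?M = "psi_graphical E \<psi> :: ('k, 'n) multiarrangement"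
  have bij: "bij v"
    using assms(2) by (auto simp: weighted_elimination_ordering_def perfect_elimination_ordering_def)
  have "\<exists>f :: 'n \<Rightarrow> 'n \<Rightarrow> ('k, 'n) pring. \<forall>k. f k \<in> splines E \<psi> \<and> (\<forall>i<k. f k (v i) = 0) \<and> f k (v k) \<noteq> 0 \<and>
    (\<forall>g\<in>splines E \<psi>. (\<forall>i<k. g (v i) = 0) \<longrightarrow> f k (v k) dvd g (v k))"
    by (rule choice) (use triangular_splines[OF assms] in blast)
  then obtain f :: "'n \<Rightarrow> 'n \<Rightarrow> ('k, 'n) pring" where f: "\<And>k. f k \<in> splines E \<psi>" "\<And>k i. i < k \<Longrightarrow> f k (v i) = 0" "\<And>k. f k (v k) \<noteq> 0"
    "\<And>k g. g \<in> splines E \<psi> \<Longrightarrow> (\<And>i. i < k \<Longrightarrow> g (v i) = 0) \<Longrightarrow> f k (v k) dvd g (v k)"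
    by metis
  define \<theta> where "\<theta> k = derivation_of (f k)" for k
  have \<theta>_var [simp]: "\<theta> k (var i) = f k i" for k i by (simp add: \<theta>_def)
  have log: "\<theta> k \<in> log_der ?M" for k
    by (simp add: log_der_iff_splines[OF assms(1)] f(1)) (simp add: \<theta>_def derivation_derivation_of)
  have inj: "inj \<theta>"
  proof (rule linorder_injI)
    fix j k :: 'n assume "j < k"
    then show "\<theta> j \<noteq> \<theta> k"
      using f(2,3) by (metis \<theta>_var)
  qed
  have comb: "(\<Sum>b\<in>range \<theta>. der_scale (u b) b) = (\<Sum>k\<in>UNIV. der_scale (u (\<theta> k)) (\<theta> k))" for u
    by (simp add: sum.reindex[OF inj])
  have "der.independent (range \<theta>)"
    unfolding der.dependent_finite[OF finite_imageI[OF finite, of \<theta>]]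
  proof (safe)
    fix u k assume zero: "(\<Sum>b\<in>range \<theta>. der_scale (u b) b) = 0" and "u (\<theta> k) \<noteq> 0"
    define m where "m = Min {k. u (\<theta> k) \<noteq> 0}"
    have "m \<in> {k. u (\<theta> k) \<noteq> 0}"
      unfolding m_def by (rule Min_in) (use \<open>u (\<theta> k) \<noteq> 0\<close> in auto)
    have less: "u (\<theta> i) = 0" if "i < m" for i
    proof (rule ccontr)
      assume "u (\<theta> i) \<noteq> 0"
      then have "m \<le> i" unfolding m_def by (intro Min_le) auto
      with that show False by simp
    qed
    have "0 = (\<Sum>k\<in>UNIV. u (\<theta> k) * f k (v m))"
      using fun_cong[OF zero, of "var (v m)"] unfolding comb der_sum_apply by simp
    also have "\<dots> = (\<Sum>k\<in>UNIV. if k = m then u (\<theta> m) * f m (v m) else 0)"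
    proof (rule sum.cong[OF refl])
      fix k show "u (\<theta> k) * f k (v m) = (if k = m then u (\<theta> m) * f m (v m) else 0)"
        by (cases k m rule: linorder_cases) (auto simp: less f(2))
    qed
    finally show False
      using \<open>m \<in> _\<close> f(3) by simp
  qed
  moreover have "der.span (range \<theta>) = log_der ?M"
  proof
    show "der.span (range \<theta>) \<subseteq> log_der ?M"
      using der.span_minimal[OF _ subspace_log_der] log by blast
    show "log_der ?M \<subseteq> der.span (range \<theta>)"
    proof
      fix \<eta> assume \<eta>: "\<eta> \<in> log_der ?M"
      define g where "g = (\<lambda>i. \<eta> (var i))"
      have g: "g \<in> splines E \<psi>"
        using \<eta> by (simp add: log_der_iff_splines[OF assms(1)] g_def)
      have "\<exists>c. \<forall>i\<in>A. g (v i) = (\<Sum>k\<in>A. c k * f k (v i))"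
        if "finite A" "\<forall>i\<in>A. {..<i} \<subseteq> A" for A
        using that
      proof (induction A rule: finite_linorder_max_induct)
        case (insert b A)
        from insert.prems insert.hyps(2) have A: "A = {..<b}" by auto
        have down: "\<forall>i\<in>A. {..<i} \<subseteq> A"
          unfolding A by auto
        from insert.IH[OF down] obtain c where c: "\<And>i. i < b \<Longrightarrow> g (v i) = (\<Sum>k\<in>A. c k * f k (v i))"
          using A by blast
        have "f b (v b) dvd g (v b) - (\<Sum>k\<in>A. c k * f k (v b))"
          by (rule f(4)[where g = "\<lambda>i. g i - (\<Sum>k\<in>A. c k * f k i)"])
            (auto intro!: splines_diff g splines_sum f(1) simp: c)
        then obtain d where d: "g (v b) - (\<Sum>k\<in>A. c k * f k (v b)) = f b (v b) * d" ..
        have upd: "(\<Sum>k\<in>A. (c(b := d)) k * f k i) = (\<Sum>k\<in>A. c k * f k i)" for i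
          by (rule sum.cong) (auto simp: A)
        have "g (v i) = (\<Sum>k\<in>insert b A. (c(b := d)) k * f k (v i))" if "i \<in> insert b A" for i
        proof -
          have "(\<Sum>k\<in>insert b A. (c(b := d)) k * f k (v i)) = d * f b (v i) + (\<Sum>k\<in>A. c k * f k (v i))"
            using upd[of "v i"] by (subst sum.insert) (auto simp: A)
          with that d show ?thesis by (auto simp: A c f(2) algebra_simps)
        qed
        then show ?case by blast
      qed simp
      from this[of UNIV] obtain c where "\<And>i. g (v i) = (\<Sum>k\<in>UNIV. c k * f k (v i))" by auto
      then have c: "g i = (\<Sum>k\<in>UNIV. c k * f k i)" for i
        using bij by (metis bij_pointE)
      have "\<eta> = (\<Sum>k\<in>UNIV. der_scale (c k) (\<theta> k))"
      proof (rule derivation_eqI)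
        have "(\<Sum>k\<in>UNIV. der_scale (c k) (\<theta> k)) \<in> log_der ?M"
          by (intro der.subspace_sum der.subspace_scale subspace_log_der log)
        then show "derivation (\<Sum>k\<in>UNIV. der_scale (c k) (\<theta> k))"
          by (rule log_der_derivation)
        show "\<eta> (var i) = (\<Sum>k\<in>UNIV. der_scale (c k) (\<theta> k)) (var i)" for i
          using c[of i] by (simp add: der_sum_apply g_def)
      qed (rule log_der_derivation[OF \<eta>])
      also have "\<dots> \<in> der.span (range \<theta>)"
        by (intro der.span_sum der.span_scale der.span_base) auto
      finally show "\<eta> \<in> der.span (range \<theta>)" .
    qed
  qed
  ultimately have "log_der_basis ?M \<theta>"
    using inj by (simp add: log_der_basis_def)
  moreover have "lower_triangular (coefficient_matrix (\<lambda>i. axis (v i) 1) \<theta>)"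
    by (simp add: lower_triangular_def coefficient_matrix_def linear_form_axis f(2))
  ultimately show ?thesis by blast
qed

lemma coordinates_axis:
  assumes "bij v"
  shows "coordinates (\<lambda>i. axis (v i) 1 :: 'k::field ^ 'n::finite)"
proof -
  have "range (\<lambda>i. axis (v i) 1 :: 'k ^ 'n) = (\<lambda>i. axis i 1) ` range v"
    by auto
  also have "\<dots> = cart_basis"
    using bij_is_surj[OF assms] by (auto simp: cart_basis_def)
  finally show ?thesis
    using bij_is_inj[OF assms] unfolding coordinates_def
    by (auto simp: independent_cart_basis span_cart_basis inj_on_def axis_eq_axis)
qed

section \<open>Weighted elimination orderings from forbidden paths\<close>

definition induced_path :: "'n set set \<Rightarrow> (nat \<Rightarrow> 'n) \<Rightarrow> nat \<Rightarrow> bool" where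
  "induced_path E p m \<longleftrightarrow> inj_on p {..m} \<and>
    (\<forall>i\<le>m. \<forall>j\<le>m. {p i, p j} \<in> E \<longleftrightarrow> i = Suc j \<or> j = Suc i)"

text \<open>
  A hole is an induced cycle with at least four vertices, with one vertex \<open>q\<close> singled out. The
  chosen encoding makes it parallel to a valley: adjacency to \<open>q\<close> plays the role of a weight above \<open>c\<close>.
\<close>

definition hole :: "'n set set \<Rightarrow> (nat \<Rightarrow> 'n) \<Rightarrow> nat \<Rightarrow> 'n \<Rightarrow> bool" where
  "hole E p m q \<longleftrightarrow> 2 \<le> m \<and> induced_path E p m \<and> q \<notin> p ` {..m} \<and>
    (\<forall>i\<le>m. {q, p i} \<in> E \<longleftrightarrow> i = 0 \<or> i = m)"

definition valley_path :: "'n set set \<Rightarrow> ('n \<Rightarrow> nat) \<Rightarrow> (nat \<Rightarrow> 'n) \<Rightarrow> nat \<Rightarrow> nat \<Rightarrow> bool" where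
  "valley_path E \<psi> p m c \<longleftrightarrow> 2 \<le> m \<and> induced_path E p m \<and> c < \<psi> (p 0) \<and> c < \<psi> (p m) \<and>
    (\<forall>i. 0 < i \<and> i < m \<longrightarrow> \<psi> (p i) = c)"

definition reachable_within :: "'n set set \<Rightarrow> 'n set \<Rightarrow> 'n \<Rightarrow> 'n \<Rightarrow> bool" where
  "reachable_within E X = (\<lambda>x y. x \<in> X \<and> y \<in> X \<and> {x, y} \<in> E)\<^sup>*\<^sup>*"

definition walk_through :: "'n set set \<Rightarrow> 'n set \<Rightarrow> 'n \<Rightarrow> 'n \<Rightarrow> (nat \<Rightarrow> 'n) \<Rightarrow> nat \<Rightarrow> bool" where
  "walk_through E C a b p m \<longleftrightarrow> p 0 = a \<and> p m = b \<and>
    (\<forall>i<m. {p i, p (Suc i)} \<in> E) \<and> (\<forall>i. 0 < i \<and> i < m \<longrightarrow> p i \<in> C)"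

text \<open>
  A shortcut: the part of the walk between \<open>i\<close> and \<open>j\<close> is dropped when the two vertices coincide
  (\<open>d = 0\<close>), or replaced by one edge when they are adjacent (\<open>d = 1\<close>).
\<close>

lemma walk_through_cut:
  assumes "walk_through E C a b p m" "i \<le> m" "j \<le> m" "i + d < j"
    and "d = 0 \<and> p i = p j \<or> d = 1 \<and> {p i, p j} \<in> E"
  shows "walk_through E C a b (\<lambda>k. if k \<le> i then p k else p (k + (j - i - d))) (m - (j - i - d))"
proof -
  define e where "e = j - i - d"
  have e: "0 < e" "i + e + d = j" using assms(4) by (auto simp: e_def)
  have p: "p 0 = a" "p m = b" "\<And>k. k < m \<Longrightarrow> {p k, p (Suc k)} \<in> E"
    "\<And>k. 0 < k \<Longrightarrow> k < m \<Longrightarrow> p k \<in> C"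
    using assms(1) by (auto simp: walk_through_def)
  show ?thesis
    unfolding walk_through_def e_def[symmetric]
  proof (intro conjI allI impI)
    show "(if m - e \<le> i then p (m - e) else p (m - e + e)) = b"
    proof (cases "m - e \<le> i")
      case True
      with e assms(3) have "d = 0" "j = m" "m - e = i" by linarith+
      with assms(5) p(2) show ?thesis by simp
    qed (use p(2) e assms(3) in auto)
  next
    fix k assume k: "k < m - e"
    consider "k < i" | "k = i" | "i < k" by linarith
    then show "{if k \<le> i then p k else p (k + e), if Suc k \<le> i then p (Suc k) else p (Suc k + e)} \<in> E"
    proof cases
      case 1
      with p(3)[of k] k show ?thesis by simp
    next
      case 2
      from assms(5) show ?thesis
      proof
        assume "d = 0 \<and> p i = p j"
        with 2 p(3)[of j] k e show ?thesis by simp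
      next
        assume d: "d = 1 \<and> {p i, p j} \<in> E"
        then have "Suc (i + e) = j" using e by simp
        with d 2 show ?thesis by simp
      qed
    next
      case 3
      with p(3)[of "k + e"] k show ?thesis by simp
    qed
  next
    fix k assume k: "0 < k \<and> k < m - e"
    then have "k < m" "k + e < m" by auto
    with k p(4)[of k] p(4)[of "k + e"] show "(if k \<le> i then p k else p (k + e)) \<in> C" by simp
  qed (use p(1) in simp)
qed

text \<open>
  A shortest walk admits no shortcut and is therefore an induced path.
\<close>

lemma induced_path_through:
  assumes "walk_through E C a b p m" "a \<noteq> b" "{a, b} \<notin> E" and loopless: "\<And>x. {x} \<notin> E"
  shows "\<exists>p m. 2 \<le> m \<and> induced_path E p m \<and> p 0 = a \<and> p m = b \<and> (\<forall>i. 0 < i \<and> i < m \<longrightarrow> p i \<in> C)"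
proof -
  define M where "M = (LEAST m. \<exists>p. walk_through E C a b p m)"
  have "\<exists>p. walk_through E C a b p M"
    unfolding M_def by (rule LeastI[of _ m]) (use assms(1) in blast)
  then obtain p where p: "walk_through E C a b p M" by blast
  have shortest: "M \<le> m'" if "walk_through E C a b p' m'" for p' m'
    unfolding M_def by (rule Least_le) (use that in blast)
  have cut: "\<not> (d = 0 \<and> p i = p j \<or> d = 1 \<and> {p i, p j} \<in> E)" if "j \<le> M" "i + d < j" for i j d
    using shortest[OF walk_through_cut[OF p _ that(1) that(2)]] that by auto
  have ends: "p 0 = a" "p M = b" and step: "\<And>i. i < M \<Longrightarrow> {p i, p (Suc i)} \<in> E"
    and int: "\<And>i. 0 < i \<Longrightarrow> i < M \<Longrightarrow> p i \<in> C"
    using p by (auto simp: walk_through_def)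
  have M: "2 \<le> M"
  proof (rule ccontr)
    assume "\<not> 2 \<le> M"
    then consider "M = 0" | "M = 1" by linarith
    then show False
      using ends step[of 0] assms(2,3) by cases auto
  qed
  have "inj_on p {..M}"
    by (rule linorder_inj_onI) (use cut[of _ _ 0] in auto)
  moreover have "{p i, p j} \<in> E \<longleftrightarrow> i = Suc j \<or> j = Suc i" if "i \<le> M" "j \<le> M" for i j
  proof -
    have adj: "{p i, p j} \<in> E \<longleftrightarrow> j = Suc i" if "i < j" "j \<le> M" for i j
      using cut[of j i 1] step[of i] that by (cases "j = Suc i") auto
    show ?thesis
    proof (cases i j rule: linorder_cases)
      case less
      with adj[OF less that(2)] show ?thesis by simp
    next
      case equal
      with loopless[of "p i"] show ?thesis by simp
    next
      case greater
      with adj[OF greater that(1)] show ?thesis by (simp add: insert_commute[of "p i"])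
    qed
  qed
  ultimately have "induced_path E p M"
    by (simp add: induced_path_def)
  with M ends int show ?thesis by blast
qed

lemma reachable_within_sym: "reachable_within E X x y \<Longrightarrow> reachable_within E X y x"
  unfolding reachable_within_def
proof (induction rule: rtranclp_induct)
  case (step y z)
  then have "z \<in> X \<and> y \<in> X \<and> {z, y} \<in> E" by (simp add: insert_commute)
  then show ?case using step.IH by (rule converse_rtranclp_into_rtranclp)
qed simp

definition component :: "'n set set \<Rightarrow> 'n set \<Rightarrow> 'n \<Rightarrow> 'n set" where
  "component E X x = {y. reachable_within E X x y}"

definition boundary :: "'n set set \<Rightarrow> 'n set \<Rightarrow> 'n set" where
  "boundary E C = {u. u \<notin> C \<and> (\<exists>w\<in>C. {u, w} \<in> E)}"

lemma component_props:
  assumes "x \<in> X"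
  shows "x \<in> component E X x" "component E X x \<subseteq> X" "boundary E (component E X x) \<inter> X = {}"
proof -
  show "x \<in> component E X x"
    by (simp add: component_def reachable_within_def)
  have "y \<in> X" if "reachable_within E X x y" for y
    using that unfolding reachable_within_def by induction (auto simp: assms)
  then show sub: "component E X x \<subseteq> X"
    by (auto simp: component_def)
  have "u \<in> component E X x" if "u \<in> X" "w \<in> component E X x" "{u, w} \<in> E" for u w
    using that sub unfolding component_def reachable_within_def mem_Collect_eq
    by (intro rtranclp.rtrancl_into_rtrancl[of _ x w u]) (auto simp: insert_commute)
  then show "boundary E (component E X x) \<inter> X = {}"
    by (auto simp: boundary_def)
qed

lemma walk_within:
  assumes "reachable_within E X y z" "y \<in> X"
  shows "\<exists>p m. p 0 = y \<and> p m = z \<and> (\<forall>i<m. {p i, p (Suc i)} \<in> E) \<and> (\<forall>i\<le>m. p i \<in> X \<and> reachable_within E X y (p i))"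
  using assms(1) unfolding reachable_within_def
proof induction
  case base
  show ?case by (rule exI[of _ "\<lambda>_. y"], rule exI[of _ 0]) (simp add: assms(2))
next
  case (step z w)
  then obtain p m where p: "p 0 = y" "p m = z" "\<forall>i<m. {p i, p (Suc i)} \<in> E"
    "\<forall>i\<le>m. p i \<in> X \<and> (\<lambda>x y. x \<in> X \<and> y \<in> X \<and> {x, y} \<in> E)\<^sup>*\<^sup>* y (p i)" by blast
  have "(\<lambda>x y. x \<in> X \<and> y \<in> X \<and> {x, y} \<in> E)\<^sup>*\<^sup>* y w"
    using step.hyps by (rule rtranclp.rtrancl_into_rtrancl)
  then show ?case
    using p step.hyps
    by (intro exI[of _ "p(Suc m := w)"] exI[of _ "Suc m"]) (auto simp: less_Suc_eq le_Suc_eq)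
qed

lemma boundary_pair:
  assumes "x \<in> X" "a \<in> boundary E (component E X x)" "b \<in> boundary E (component E X x)"
    and "a \<noteq> b" "{a, b} \<notin> E" and loopless: "\<And>x. {x} \<notin> E"
  shows "\<exists>p m. 2 \<le> m \<and> induced_path E p m \<and> p 0 = a \<and> p m = b \<and>
    (\<forall>i. 0 < i \<and> i < m \<longrightarrow> p i \<in> component E X x)"
proof -
  let ?C = "component E X x"
  from assms(2,3) obtain y z where yz: "y \<in> ?C" "{a, y} \<in> E" "z \<in> ?C" "{b, z} \<in> E"
    by (auto simp: boundary_def)
  have y: "reachable_within E X x y" "y \<in> X"
    using yz component_props(2)[OF assms(1), of E] by (auto simp: component_def)
  have "reachable_within E X y z"
    using reachable_within_sym[OF y(1)] yz(3)
    unfolding component_def reachable_within_def mem_Collect_eq by (rule rtranclp_trans)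
  then obtain p m where p: "p 0 = y" "p m = z" "\<forall>i<m. {p i, p (Suc i)} \<in> E"
    "\<forall>i\<le>m. p i \<in> X \<and> reachable_within E X y (p i)"
    using walk_within[of E X y z] y(2) by blast
  have C: "p i \<in> ?C" if "i \<le> m" for i
  proof -
    have "reachable_within E X y (p i)" using p(4) that by simp
    with y(1) show ?thesis
      unfolding component_def reachable_within_def mem_Collect_eq by (rule rtranclp_trans)
  qed
  define p' where "p' k = (if k = 0 then a else if k \<le> Suc m then p (k - 1) else b)" for k
  have "walk_through E ?C a b p' (Suc (Suc m))"
    unfolding walk_through_def
  proof (intro conjI allI impI)
    fix i assume "i < Suc (Suc m)"
    then consider "i = 0" | "0 < i" "i \<le> m" | "i = Suc m" by linarith
    then show "{p' i, p' (Suc i)} \<in> E"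
    proof cases
      case 1
      then show ?thesis using yz p(1) by (simp add: p'_def)
    next
      case 2
      then obtain k where k: "i = Suc k" by (cases i) auto
      with 2 p(3) have "{p k, p (Suc k)} \<in> E" by simp
      with 2 k show ?thesis by (simp add: p'_def)
    next
      case 3
      then show ?thesis using yz p(2) by (simp add: p'_def insert_commute)
    qed
  next
    fix i assume "0 < i \<and> i < Suc (Suc m)"
    then obtain k where "i = Suc k" "k \<le> m" by (cases i) auto
    with C[of k] show "p' i \<in> ?C" by (simp add: p'_def)
  qed (simp_all add: p'_def)
  from induced_path_through[OF this assms(4-6)] show ?thesis .
qed

definition clique :: "'n set set \<Rightarrow> 'n set \<Rightarrow> bool" where
  "clique E K \<longleftrightarrow> (\<forall>u\<in>K. \<forall>w\<in>K. u \<noteq> w \<longrightarrow> {u, w} \<in> E)"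

text \<open>
  Dirac's argument. If \<open>U\<close> is not a clique, choose a vertex \<open>v\<close> with a non-neighbour, inside \<open>K\<close> if
  possible, and let \<open>C\<close> be a component of the set of non-neighbours of \<open>v\<close>. All boundary vertices of
  \<open>C\<close> are adjacent to \<open>v\<close>, so two non-adjacent ones among them would, with a path through \<open>C\<close>, form a
  hole at \<open>v\<close>. Thus the boundary is a clique, and by induction \<open>C\<close> contains a vertex that is simplicial
  in \<open>C\<close> and its boundary, hence in \<open>U\<close>. It is not adjacent to \<open>v\<close> and so, by the choice of \<open>v\<close>, not in \<open>K\<close>.
\<close>

lemma simplicial_outside_clique:
  fixes U :: "'n::finite set"
  assumes "clique E K" "K \<subset> U" and loopless: "\<And>x. {x} \<notin> E"
    and no_hole: "\<And>p m q. \<not> hole E p m q"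
  shows "\<exists>w\<in>U - K. clique E {u \<in> U. {u, w} \<in> E}"
proof -
  have "finite U" by simp
  then show ?thesis using assms(1,2)
  proof (induction U arbitrary: K rule: finite_psubset_induct)
    case (psubset U)
    show ?case
    proof (cases "clique E U")
      case True
      with psubset.prems(2) show ?thesis by (auto simp: clique_def)
    next
      case False
      define dominating where "dominating v \<longleftrightarrow> (\<forall>u\<in>U. u \<noteq> v \<longrightarrow> {u, v} \<in> E)" for v
      have "\<exists>v\<in>U. \<not> dominating v \<and> (v \<in> K \<or> (\<forall>x\<in>K. dominating x))"
      proof (cases "\<exists>v\<in>K. \<not> dominating v")
        case True
        with psubset.prems(2) show ?thesis by blast
      next
        case K: False
        from False obtain u v where "u \<in> U" "v \<in> U" "u \<noteq> v" "{u, v} \<notin> E"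
          unfolding clique_def by blast
        then have "v \<in> U \<and> \<not> dominating v" by (auto simp: dominating_def)
        with K show ?thesis by blast
      qed
      then obtain v where v: "v \<in> U" "\<not> dominating v" "v \<in> K \<or> (\<forall>x\<in>K. dominating x)" by blast
      define X where "X = {u \<in> U. u \<noteq> v \<and> {u, v} \<notin> E}"
      from v(2) obtain x where x: "x \<in> X" by (auto simp: dominating_def X_def)
      define C where "C = component E X x"
      have C: "x \<in> C" "C \<subseteq> X" "boundary E C \<inter> X = {}"
        using component_props[OF x] by (auto simp: C_def)
      have v_notin: "v \<notin> boundary E C" 
        using C(2) by (auto simp: boundary_def X_def insert_commute)
      define K' where "K' = boundary E C \<inter> U"
      have K'_nbr: "{u, v} \<in> E" if "u \<in> K'" for u
        using that C(3) v_notin by (auto simp: K'_def X_def)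
      have "clique E K'"
        unfolding clique_def
      proof (intro ballI impI, rule ccontr)
        fix a b assume ab: "a \<in> K'" "b \<in> K'" "a \<noteq> b" "{a, b} \<notin> E"
        then have "a \<in> boundary E C" "b \<in> boundary E C" by (auto simp: K'_def)
        from boundary_pair[OF x this[unfolded C_def] ab(3,4) loopless, folded C_def]
        obtain p m where p: "2 \<le> m" "induced_path E p m" "p 0 = a" "p m = b"
          "\<And>i. 0 < i \<Longrightarrow> i < m \<Longrightarrow> p i \<in> C" by blast
        have "{v, p i} \<in> E \<longleftrightarrow> i = 0 \<or> i = m" "v \<noteq> p i" if im: "i \<le> m" for i
        proof -
          consider "i = 0" | "i = m" | "0 < i" "i < m" using im by linarith
          then have "({v, p i} \<in> E \<longleftrightarrow> i = 0 \<or> i = m) \<and> v \<noteq> p i"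
          proof cases
            case 3
            then have "p i \<in> X" using p(5) C(2) by blast
            with 3 show ?thesis by (auto simp: X_def insert_commute)
          qed (use K'_nbr[OF ab(1)] K'_nbr[OF ab(2)] p(3,4) loopless[of v] in \<open>auto simp: insert_commute\<close>)
          then show "{v, p i} \<in> E \<longleftrightarrow> i = 0 \<or> i = m" "v \<noteq> p i" by auto
        qed
        then have "hole E p m v"
          unfolding hole_def using p(1,2) by auto
        with no_hole show False by blast
      qed
      moreover have "K' \<subset> C \<union> K'"
        using C(1) by (auto simp: K'_def boundary_def)
      moreover have "C \<union> K' \<subset> U"
        using C(2) v_notin v(1) by (auto simp: K'_def X_def)
      ultimately obtain w where w: "w \<in> C" "clique E {u \<in> C \<union> K'. {u, w} \<in> E}"
        using psubset.IH[of "C \<union> K'" K'] by blast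
      have "{u \<in> U. {u, w} \<in> E} \<subseteq> {u \<in> C \<union> K'. {u, w} \<in> E}"
        using w(1) by (auto simp: K'_def boundary_def)
      then have "clique E {u \<in> U. {u, w} \<in> E}"
        using w(2) unfolding clique_def by blast
      moreover have "w \<in> U - K"
      proof -
        have X: "w \<in> U" "w \<noteq> v" "{w, v} \<notin> E" "{v, w} \<notin> E"
          using w(1) C(2) by (auto simp: X_def insert_commute)
        have "w \<notin> K"
        proof
          assume "w \<in> K"
          with v(3) show False
            using X v(1) psubset.prems(1) unfolding clique_def dominating_def by metis
        qed
        with X show ?thesis by blast
      qed
      ultimately show ?thesis by blast
    qed
  qed
qed

text \<open>
  Two non-adjacent boundary vertices of a component \<open>C\<close> of the lightest vertices would be the ends of a
  valley through \<open>C\<close>, so the boundary is a clique, and a simplicial vertex is found in \<open>C\<close>.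
\<close>

lemma simplicial_sink:
  fixes U :: "'n::finite set"
  assumes "U \<noteq> {}" and loopless: "\<And>x. {x} \<notin> E"
    and no_hole: "\<And>p m q. \<not> hole E p m q" and no_valley: "\<And>p m c. \<not> valley_path E \<psi> p m c"
  shows "\<exists>w\<in>U. clique E {u \<in> U. {u, w} \<in> E} \<and> (\<forall>u\<in>U. \<psi> w \<le> \<psi> u)"
proof -
  define c where "c = Min (\<psi> ` U)"
  define X where "X = {u \<in> U. \<psi> u = c}"
  have "c \<in> \<psi> ` U"
    unfolding c_def by (rule Min_in) (use assms(1) in auto)
  then obtain x where x: "x \<in> X" by (auto simp: X_def)
  have min: "c \<le> \<psi> u" if "u \<in> U" for u
    unfolding c_def using that by simp
  define C where "C = component E X x"
  have C: "x \<in> C" "C \<subseteq> X" "boundary E C \<inter> X = {}"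
    using component_props[OF x] by (auto simp: C_def)
  define K where "K = boundary E C \<inter> U"
  have "clique E K"
    unfolding clique_def
  proof (intro ballI impI, rule ccontr)
    fix a b assume ab: "a \<in> K" "b \<in> K" "a \<noteq> b" "{a, b} \<notin> E"
    then have "a \<in> boundary E C" "b \<in> boundary E C" by (auto simp: K_def)
    from boundary_pair[OF x this[unfolded C_def] ab(3,4) loopless, folded C_def]
    obtain p m where p: "2 \<le> m" "induced_path E p m" "p 0 = a" "p m = b"
      "\<And>i. 0 < i \<Longrightarrow> i < m \<Longrightarrow> p i \<in> C" by blast
    have "c < \<psi> u" if "u \<in> K" for u
      using that C(3) min[of u] by (auto simp: K_def X_def order.strict_iff_order)
    then have "valley_path E \<psi> p m c"
      unfolding valley_path_def using p ab(1,2) C(2) by (auto simp: X_def)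
    with no_valley show False by blast
  qed
  moreover have "K \<subset> C \<union> K"
    using C(1) by (auto simp: K_def boundary_def)
  ultimately obtain w where w: "w \<in> C" "clique E {u \<in> C \<union> K. {u, w} \<in> E}"
    using simplicial_outside_clique[of E K "C \<union> K"] loopless no_hole by blast
  have "{u \<in> U. {u, w} \<in> E} \<subseteq> {u \<in> C \<union> K. {u, w} \<in> E}"
    using w(1) by (auto simp: K_def boundary_def)
  then have "clique E {u \<in> U. {u, w} \<in> E}"
    using w(2) unfolding clique_def by blast
  moreover have "w \<in> U" "\<psi> w = c"
    using w(1) C(2) by (auto simp: X_def)
  ultimately show ?thesis using min by blast
qed

lemma elimination_list:
  fixes U :: "'n::finite set"
  assumes loopless: "\<And>x. {x} \<notin> E"
    and no_hole: "\<And>p m q. \<not> hole E p m q" and no_valley: "\<And>p m c. \<not> valley_path E \<psi> p m c"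
  shows "\<exists>xs. distinct xs \<and> set xs = U \<and>
    (\<forall>i<length xs. clique E {u \<in> set (take i xs). {u, xs ! i} \<in> E} \<and>
      (\<forall>u\<in>set (take i xs). \<psi> (xs ! i) \<le> \<psi> u))"
proof -
  have "finite U" by simp
  then show ?thesis
  proof (induction U rule: finite_psubset_induct)
    case (psubset U)
    show ?case
    proof (cases "U = {}")
      case False
      from simplicial_sink[OF this assms] obtain w where
        w: "w \<in> U" "clique E {u \<in> U. {u, w} \<in> E}" "\<And>u. u \<in> U \<Longrightarrow> \<psi> w \<le> \<psi> u" by blast
      from psubset.IH[of "U - {w}"] w(1) obtain xs where
        xs: "distinct xs" "set xs = U - {w}"
        "\<And>i. i < length xs \<Longrightarrow> clique E {u \<in> set (take i xs). {u, xs ! i} \<in> E} \<and>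
          (\<forall>u\<in>set (take i xs). \<psi> (xs ! i) \<le> \<psi> u)" by blast
      have "{u \<in> U - {w}. {u, w} \<in> E} \<subseteq> {u \<in> U. {u, w} \<in> E}" by auto
      then have "clique E {u \<in> U - {w}. {u, w} \<in> E}"
        using w(2) unfolding clique_def by blast
      with xs w show ?thesis
        by (intro exI[of _ "xs @ [w]"]) (auto simp: nth_append less_Suc_eq)
    qed simp
  qed
qed

lemma weighted_elimination_ordering_if_no_obstruction:
  fixes E :: "'n::{finite,linorder} set set"
  assumes "simple_graph E"
    and no_hole: "\<And>p m q. \<not> hole E p m q" and no_valley: "\<And>p m c. \<not> valley_path E \<psi> p m c"
  shows "\<exists>v. weighted_elimination_ordering E \<psi> v"
proof -
  have loopless: "{x} \<notin> E" for x
    using simple_graph_neq[OF assms(1), of x x] by auto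
  from elimination_list[OF loopless no_hole no_valley, of UNIV] obtain xs where
    xs: "distinct xs" "set xs = (UNIV :: 'n set)"
    "\<And>i. i < length xs \<Longrightarrow> clique E {u \<in> set (take i xs). {u, xs ! i} \<in> E}"
    "\<And>i u. i < length xs \<Longrightarrow> u\<in>set (take i xs) \<Longrightarrow> \<psi> (xs ! i) \<le> \<psi> u" by blast
  define r where "r i = card {..<i}" for i :: 'n
  have len: "length xs = CARD('n)"
    using xs(1,2) distinct_card by fastforce
  have r_mono: "r i < r j" if "i < j" for i j
    unfolding r_def by (rule psubset_card_mono) (use that in auto)
  have r_less: "r i < length xs" for i
    unfolding len r_def by (rule psubset_card_mono) auto
  have inj_r: "inj r"
    by (rule linorder_injI) (metis r_mono less_irrefl)
  define v where "v i = xs ! r i" for i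
  have "inj v"
    unfolding v_def using inj_r r_less xs(1) by (auto simp: inj_def nth_eq_iff_index_eq)
  then have bij: "bij v"
    by (simp add: bij_def finite_UNIV_inj_surj)
  have earlier: "v j \<in> set (take (r i) xs)" if "j < i" for i j
  proof -
    have "take (r i) xs ! r j \<in> set (take (r i) xs)"
      by (rule nth_mem) (use r_mono[OF that] r_less[of j] in simp)
    then show ?thesis using r_mono[OF that] by (simp add: v_def)
  qed
  have "simplicial (induced_edges E (v ` {..i})) (v i)" for i
    unfolding simplicial_def
  proof (intro ballI impI)
    fix u w assume uw: "u \<in> neighbors (induced_edges E (v ` {..i})) (v i)"
      "w \<in> neighbors (induced_edges E (v ` {..i})) (v i)" "u \<noteq> w"
    have *: "y \<in> {u \<in> set (take (r i) xs). {u, xs ! r i} \<in> E} \<and> y \<in> v ` {..i}"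
      if y: "y \<in> neighbors (induced_edges E (v ` {..i})) (v i)" for y
    proof -
      from y obtain j where j: "j \<le> i" "y = v j" "{y, v i} \<in> E"
        by (auto simp: neighbors_def induced_edges_def)
      then have "j \<noteq> i" using loopless by auto
      with j earlier[of j i] show ?thesis by (auto simp: v_def)
    qed
    show "{u, w} \<in> induced_edges E (v ` {..i})"
      using xs(3)[OF r_less[of i]] *[OF uw(1)] *[OF uw(2)] uw(3)
      by (auto simp: clique_def induced_edges_def)
  qed
  moreover have "\<psi> (v j) \<le> \<psi> (v i)" if "i < j" for i j
    using xs(4)[OF r_less earlier[OF that]] by (simp add: v_def)
  ultimately show ?thesis
    using bij unfolding weighted_elimination_ordering_def perfect_elimination_ordering_def by blast
qed

section \<open>Homogeneous linear systems and the rank of the module\<close>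

text \<open>
  Gaussian elimination without division: a pivot equation is used to eliminate one unknown after
  cross-multiplication. Used below to compare the sizes of generating and independent sets.
\<close>

lemma homogeneous_system:
  fixes a :: "'j \<Rightarrow> 'k \<Rightarrow> 'a::idom"
  assumes "finite J" "finite K" "card J < card K"
  shows "\<exists>x. (\<exists>k\<in>K. x k \<noteq> 0) \<and> (\<forall>j\<in>J. (\<Sum>k\<in>K. a j k * x k) = 0)"
  using assms
proof (induction J arbitrary: K a)
  case empty
  then obtain k where "k \<in> K" by fastforce
  then show ?case by (intro exI[of _ "\<lambda>_. 1"]) auto
next
  case (insert j0 J)
  show ?case
  proof (cases "\<forall>k\<in>K. a j0 k = 0")
    case True
    have "card J < card K" using insert.prems insert.hyps by simp
    from insert.IH[OF insert.prems(1) this, of a] obtain x where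
      "\<exists>k\<in>K. x k \<noteq> 0" "\<forall>j\<in>J. (\<Sum>k\<in>K. a j k * x k) = 0" by blast
    with True show ?thesis by (intro exI[of _ x]) simp
  next
    case False
    then obtain k0 where k0: "k0 \<in> K" "a j0 k0 \<noteq> 0" by blast
    let ?K = "K - {k0}"
    have "card J < card ?K" using insert.prems insert.hyps k0 by simp
    from insert.IH[of ?K "\<lambda>j k. a j0 k0 * a j k - a j k0 * a j0 k", OF _ this] insert.prems(1)
    obtain x where x: "\<exists>k\<in>?K. x k \<noteq> 0"
      "\<And>j. j \<in> J \<Longrightarrow> (\<Sum>k\<in>?K. (a j0 k0 * a j k - a j k0 * a j0 k) * x k) = 0" by auto
    define y where "y k = (if k = k0 then - (\<Sum>k\<in>?K. a j0 k * x k) else a j0 k0 * x k)" for k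
    have y: "(\<Sum>k\<in>K. a j k * y k) = (\<Sum>k\<in>?K. (a j0 k0 * a j k - a j k0 * a j0 k) * x k)" for j
    proof -
      have "(\<Sum>k\<in>K. a j k * y k) = a j k0 * y k0 + (\<Sum>k\<in>?K. a j k * y k)"
        using k0 insert.prems(1) by (subst sum.remove[of K k0]) auto
      also have "(\<Sum>k\<in>?K. a j k * y k) = (\<Sum>k\<in>?K. a j k * (a j0 k0 * x k))"
        by (rule sum.cong) (auto simp: y_def)
      also have "a j k0 * y k0 = (\<Sum>k\<in>?K. - (a j k0 * (a j0 k * x k)))"
        by (simp add: y_def sum_distrib_left sum_negf)
      finally show ?thesis
        by (simp add: sum.distrib[symmetric] algebra_simps)
    qed
    have "\<forall>j\<in>insert j0 J. (\<Sum>k\<in>K. a j k * y k) = 0"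
      unfolding y using x(2) by (simp add: mult.commute)
    moreover from x(1) obtain k where "k \<in> ?K" "x k \<noteq> 0" by blast
    then have "k \<in> K \<and> y k \<noteq> 0" using k0(2) by (auto simp: y_def)
    ultimately show ?thesis by blast
  qed
qed

text \<open>
  The hyperplanes are indexed by the vertices (coordinate hyperplanes) and the edges. The sign of the
  form of an edge is fixed by the order of the vertices.
\<close>

fun form :: "'n + 'n set \<Rightarrow> ('k::field, 'n::linorder) pring" where
  "form (Inl i) = var i"
| "form (Inr e) = var (Min e) - var (Max e)"

fun form_multiplicity :: "('n \<Rightarrow> nat) \<Rightarrow> 'n + 'n set \<Rightarrow> nat" where
  "form_multiplicity \<psi> (Inl i) = \<psi> i"
| "form_multiplicity \<psi> (Inr e) = 1"

definition hyperplane_indices :: "'n set set \<Rightarrow> ('n + 'n set) set" where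
  "hyperplane_indices E = range Inl \<union> Inr ` E"

lemma finite_hyperplane_indices [simp]:
  "finite (hyperplane_indices (E :: 'n::finite set set))"
  by (simp add: hyperplane_indices_def)

lemma edge_Min_Max:
  fixes E :: "'n::{finite,linorder} set set"
  assumes "simple_graph E" "e \<in> E"
  shows "Min e < Max e" "e = {Min e, Max e}"
proof -
  from assms have "card e = 2" by (auto simp: simple_graph_def)
  then obtain a b where "e = {a, b}" "a \<noteq> b" by (auto simp: card_2_iff)
  then show "Min e < Max e" "e = {Min e, Max e}" by (auto simp: min_def max_def)
qed

lemma form_pair:
  assumes "a \<noteq> b"
  shows "form (Inr {a, b}) dvd p \<longleftrightarrow> (var a - var b :: ('k::field, 'n::linorder) pring) dvd p"
    and "(var a - var b :: ('k::field, 'n::linorder) pring) dvd form (Inr {a, b})"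
    and "form (Inr {a, b}) dvd (var a - var b :: ('k::field, 'n::linorder) pring)"
proof -
  have "form (Inr {a, b}) = (var a - var b :: ('k, 'n) pring) \<or> form (Inr {a, b}) = - (var a - var b :: ('k, 'n) pring)"
    by (auto simp: min_def max_def)
  then show "form (Inr {a, b}) dvd p \<longleftrightarrow> (var a - var b :: ('k, 'n) pring) dvd p"
    "(var a - var b :: ('k, 'n) pring) dvd form (Inr {a, b})"
    "form (Inr {a, b}) dvd (var a - var b :: ('k, 'n) pring)"
    by (metis dvd_minus_iff minus_dvd_iff dvd_refl)+
qed

lemma splinesI:
  fixes E :: "'n::{finite,linorder} set set"
  assumes "simple_graph E" "\<And>i. var i ^ \<psi> i dvd f i"
    and "\<And>e. e \<in> E \<Longrightarrow> form (Inr e) dvd f (Min e) - f (Max e)"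
  shows "f \<in> splines E \<psi>"
  unfolding splines_def
proof (intro CollectI conjI allI impI)
  fix i j assume ij: "{i, j} \<in> E"
  then have ne: "i \<noteq> j" using simple_graph_neq[OF assms(1)] by blast
  then have "f (Min {i, j}) - f (Max {i, j}) = f i - f j \<or> f (Min {i, j}) - f (Max {i, j}) = - (f i - f j)"
    by (auto simp: min_def max_def)
  then have "form (Inr {i, j}) dvd f i - f j"
    using assms(3)[OF ij] by (metis dvd_minus_iff)
  then show "var i - var j dvd f i - f j"
    using form_pair(1)[OF ne] by blast
qed (rule assms(2))

lemma prime_form:
  fixes E :: "'n::{finite,linorder} set set"
  assumes "simple_graph E" "k \<in> hyperplane_indices E"
  shows "prime_elem (form k :: ('k::field, 'n) pring)"
  using assms(2) edge_Min_Max(1)[OF assms(1)]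
  by (auto simp: hyperplane_indices_def intro!: prime_var prime_edge less_imp_neq)

lemma form_not_dvd_form:
  fixes E :: "'n::{finite,linorder} set set"
  assumes "simple_graph E" "k \<in> hyperplane_indices E" "l \<in> hyperplane_indices E" "k \<noteq> l"
  shows "\<not> form k dvd (form l :: ('k::field, 'n) pring)"
proof (cases k; cases l)
  fix i j assume "k = Inl i" "l = Inl j"
  with assms(4) show ?thesis by (simp add: dvd_var_iff)
next
  fix i e assume kl: "k = Inl i" "l = Inr e"
  with assms(3) have "Min e \<noteq> Max e"
    using edge_Min_Max(1)[OF assms(1), of e] by (auto simp: hyperplane_indices_def)
  with kl show ?thesis by (auto simp: dvd_var_iff)
next
  fix e i assume "k = Inr e" "l = Inl i"
  then show ?thesis by (simp add: dvd_edge_iff)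
next
  fix e e' assume kl: "k = Inr e" "l = Inr e'"
  with assms have e: "Min e \<noteq> Max e" "e = {Min e, Max e}" "Min e' \<noteq> Max e'" "e' = {Min e', Max e'}" "e \<noteq> e'"
    using edge_Min_Max[OF assms(1), of e] edge_Min_Max[OF assms(1), of e'] by (auto simp: hyperplane_indices_def)
  define a b c d where abcd: "a = Min e" "b = Max e" "c = Min e'" "d = Max e'"
  have "{a, b} \<noteq> {c, d}" "a \<noteq> b" "c \<noteq> d" using e unfolding abcd by metis+
  then have "subst (var(a := var b)) (var c - var d) \<noteq> (0 :: ('k, 'n) pring)"
    by (auto simp: insert_commute)
  then show ?thesis by (simp add: kl dvd_edge_iff abcd)
qed

definition defining_product :: "'n set set \<Rightarrow> ('n \<Rightarrow> nat) \<Rightarrow> ('k::field, 'n::{finite,linorder}) pring" where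
  "defining_product E \<psi> = (\<Prod>k\<in>hyperplane_indices E. form k ^ form_multiplicity \<psi> k)"

lemma form_neq_0:
  fixes E :: "'n::{finite,linorder} set set"
  shows "simple_graph E \<Longrightarrow> k \<in> hyperplane_indices E \<Longrightarrow> form k \<noteq> (0 :: ('k::field, 'n) pring)"
  using prime_form by (auto simp: prime_elem_def)

lemma form_power_dvd:
  fixes E :: "'n::{finite,linorder} set set"
  assumes "k \<in> A"
  shows "form k ^ form_multiplicity \<psi> k dvd (\<Prod>k\<in>A. form k ^ form_multiplicity \<psi> k :: ('k::field, 'n) pring)"
  by (rule dvd_prodI) (use assms in auto)

text \<open>
  A set of independent generators has as many elements as there are vertices. It is not larger,
  because derivations are determined by their values at the variables; it is not smaller, because it
  generates the nonzero multiples of all partial derivatives by the defining polynomial.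
\<close>

lemma spline_basis:
  fixes E :: "'n::{finite,linorder} set set"
  assumes "simple_graph E" "free_multiarrangement (psi_graphical E \<psi> :: ('k::field, 'n) multiarrangement)"
  shows "\<exists>F :: 'n \<Rightarrow> 'n \<Rightarrow> ('k, 'n) pring. (\<forall>j. F j \<in> splines E \<psi>) \<and>
    (\<forall>f\<in>splines E \<psi>. \<exists>c. \<forall>i. f i = (\<Sum>j\<in>UNIV. F j i * c j))"
proof -
  let ?M = "psi_graphical E \<psi> :: ('k, 'n) multiarrangement"
  from assms(2) obtain B where B: "der.independent B" "der.span B = log_der ?M"
    by (auto simp: free_multiarrangement_def)
  have B_log: "b \<in> log_der ?M" if "b \<in> B" for b
    using der.span_base[OF that] B(2) by simp
  have bound: "card T \<le> CARD('n)" if T: "finite T" "T \<subseteq> B" for T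
  proof (rule ccontr)
    assume "\<not> card T \<le> CARD('n)"
    then have "card (UNIV :: 'n set) < card T" by simp
    from homogeneous_system[OF finite T(1) this, of "\<lambda>i b. b (var i)"] obtain x where
      x: "\<exists>b\<in>T. x b \<noteq> 0" "\<And>i. (\<Sum>b\<in>T. b (var i) * x b) = 0" by auto
    have "(\<Sum>b\<in>T. der_scale (x b) b) = 0"
    proof (rule derivation_eqI)
      have "(\<Sum>b\<in>T. der_scale (x b) b) \<in> log_der ?M"
        by (intro der.subspace_sum der.subspace_scale subspace_log_der B_log) (use T in auto)
      then show "derivation (\<Sum>b\<in>T. der_scale (x b) b)" by (rule log_der_derivation)
      show "derivation (0 :: ('k, 'n) pring \<Rightarrow> ('k, 'n) pring)" by (simp add: derivation_def)
      show "(\<Sum>b\<in>T. der_scale (x b) b) (var i) = 0 (var i)" for i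
        using x(2)[of i] by (simp add: der_sum_apply[where \<theta> = "\<lambda>b. b"] mult.commute)
    qed
    with x(1) T B(1) show False
      unfolding der.dependent_explicit by blast
  qed
  then have fin: "finite B" and card_le: "card B \<le> CARD('n)"
    using finite_if_finite_subsets_card_bdd[of B "CARD('n)"] by blast+
  have gen: "\<exists>u. \<forall>i. f i = (\<Sum>b\<in>B. u b * b (var i))" if "f \<in> splines E \<psi>" for f
  proof -
    have "derivation_of f \<in> log_der ?M"
      using that by (simp add: log_der_iff_splines[OF assms(1)] derivation_derivation_of)
    then obtain u where "derivation_of f = (\<Sum>b\<in>B. der_scale (u b) b)"
      unfolding B(2)[symmetric] der.span_finite[OF fin] by blast
    then have "derivation_of f (var i) = (\<Sum>b\<in>B. u b * b (var i))" for i
      by (simp add: der_sum_apply[where \<theta> = "\<lambda>b. b"])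
    then show ?thesis by auto
  qed
  have "CARD('n) \<le> card B"
  proof (rule ccontr)
    assume "\<not> CARD('n) \<le> card B"
    then have less: "card B < card (UNIV :: 'n set)" by simp
    let ?P = "defining_product E \<psi> :: ('k, 'n) pring"
    have P: "?P \<noteq> 0"
      using form_neq_0[OF assms(1)] by (auto simp: defining_product_def)
    have dvd_P: "form k ^ form_multiplicity \<psi> k dvd ?P" if "k \<in> hyperplane_indices E" for k
      unfolding defining_product_def using form_power_dvd[OF that] .
    have "(\<lambda>i. if i = j then ?P else 0) \<in> splines E \<psi>" for j
    proof (rule splinesI[OF assms(1)])
      show "var i ^ \<psi> i dvd (if i = j then ?P else 0)" for i
        using dvd_P[of "Inl i"] by (cases "i = j") (simp_all add: hyperplane_indices_def)
      fix e assume "e \<in> E"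
      then show "form (Inr e) dvd (if Min e = j then ?P else 0) - (if Max e = j then ?P else 0)"
        using dvd_P[of "Inr e"] by (auto simp: hyperplane_indices_def)
    qed
    then have "\<exists>u. \<forall>i. (if i = j then ?P else 0) = (\<Sum>b\<in>B. u b * b (var i))" for j
      using gen by blast
    then have "\<forall>j. \<exists>u. \<forall>i. (if i = j then ?P else 0) = (\<Sum>b\<in>B. u b * b (var i))" ..
    from choice[OF this] obtain u where
      u: "\<And>i j. (if i = j then ?P else 0) = (\<Sum>b\<in>B. u j b * b (var i))" by blast
    from homogeneous_system[OF fin finite less, of "\<lambda>b j. u j b"] obtain x where
      x: "\<exists>j. x j \<noteq> 0" "\<And>b. b \<in> B \<Longrightarrow> (\<Sum>j\<in>UNIV. u j b * x j) = 0" by auto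
    have "?P * x i = 0" for i
    proof -
      have "?P * x i = (\<Sum>j\<in>UNIV. (if i = j then ?P else 0) * x j)"
        by (simp add: if_distrib[of "\<lambda>t. t * _"] cong: if_cong)
      also have "\<dots> = (\<Sum>b\<in>B. (\<Sum>j\<in>UNIV. u j b * x j) * b (var i))"
        unfolding u sum_distrib_right by (subst sum.swap) (simp add: mult_ac)
      finally show ?thesis using x(2) by simp
    qed
    with P x(1) show False by auto
  qed
  with card_le have "card (UNIV :: 'n set) = card B" by simp
  then obtain h :: "'n \<Rightarrow> _" where h: "bij_betw h UNIV B"
    using finite_same_card_bij[OF finite fin] by blast
  define F where "F j i = h j (var i)" for j i
  have "F j \<in> splines E \<psi>" for j
    using B_log[of "h j"] h unfolding F_def log_der_iff_splines[OF assms(1)]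
    by (auto simp: bij_betw_def)
  moreover have "\<exists>c. \<forall>i. f i = (\<Sum>j\<in>UNIV. F j i * c j)" if f: "f \<in> splines E \<psi>" for f
  proof -
    from gen[OF f] obtain u where "\<And>i. f i = (\<Sum>b\<in>B. u b * b (var i))" by blast
    moreover have "(\<Sum>b\<in>B. u b * b (var i)) = (\<Sum>j\<in>UNIV. F j i * u (h j))" for i
      unfolding F_def by (subst sum.reindex_bij_betw[OF h, symmetric]) (simp add: mult.commute)
    ultimately show ?thesis by auto
  qed
  ultimately show ?thesis by blast
qed

section \<open>The determinant of a basis divides the defining polynomial\<close>

text \<open>
  The prime \<open>\<alpha>\<close> occurs in \<open>d\<close> at most \<open>m\<close> times, so the exponent \<open>N\<close> can be lowered to \<open>m\<close>. One
  factor \<open>\<alpha>\<close> is removed at a time, by comparing the two multiples of \<open>d\<close> after cross-multiplication.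
\<close>

lemma dvd_strip_prime_power:
  fixes \<alpha> :: "'a::idom"
  assumes "prime_elem \<alpha>" "\<not> \<alpha> dvd A" "d dvd \<alpha> ^ m * A"
  shows "d dvd \<alpha> ^ N * B \<Longrightarrow> d dvd \<alpha> ^ m * B"
proof (induction N)
  case 0
  then show ?case by (simp add: dvd_mult)
next
  case (Suc N)
  show ?case
  proof (cases "Suc N \<le> m")
    case True
    then have "\<alpha> ^ Suc N * B dvd \<alpha> ^ m * B" by (intro mult_dvd_mono le_imp_power_dvd) auto
    with Suc.prems show ?thesis by (rule dvd_trans)
  next
    case False
    have \<alpha>: "\<alpha> \<noteq> 0" using assms(1) by (auto simp: prime_elem_def)
    obtain e where e: "\<alpha> ^ Suc N * B = d * e" using Suc.prems by (auto elim: dvdE)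
    obtain g where g: "\<alpha> ^ m * A = d * g" using assms(3) by (auto elim: dvdE)
    have "\<alpha> ^ Suc N = \<alpha> ^ m * (\<alpha> * \<alpha> ^ (N - m))"
      using False by (simp flip: power_Suc power_add) 
    then have "\<alpha> ^ m * (A * e) = \<alpha> ^ m * (\<alpha> * (\<alpha> ^ (N - m) * B * g))"
      using e g by (metis mult.assoc mult.commute)
    then have "A * e = \<alpha> * (\<alpha> ^ (N - m) * B * g)" using \<alpha> by simp
    then have "\<alpha> dvd A * e" by simp
    then have "\<alpha> dvd e" using assms(1,2) by (auto simp: prime_elem_dvd_mult_iff)
    then obtain e' where "e = \<alpha> * e'" by (auto elim: dvdE)
    with e have "\<alpha> * (\<alpha> ^ N * B) = \<alpha> * (d * e')" by (simp add: mult_ac)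
    then have "\<alpha> ^ N * B = d * e'" using \<alpha> by simp
    then show ?thesis by (intro Suc.IH) simp
  qed
qed

lemma dvd_prod_prime_powers:
  fixes \<alpha> :: "'i \<Rightarrow> 'a::idom"
  assumes "finite I" "\<And>i. i \<in> I \<Longrightarrow> prime_elem (\<alpha> i)"
    and "\<And>i. i \<in> I \<Longrightarrow> \<not> \<alpha> i dvd A i" "\<And>i. i \<in> I \<Longrightarrow> d dvd \<alpha> i ^ m i * A i"
    and "d dvd (\<Prod>i\<in>I. \<alpha> i ^ N i)"
  shows "d dvd (\<Prod>i\<in>I. \<alpha> i ^ m i)"
proof -
  have "d dvd (\<Prod>i\<in>J. \<alpha> i ^ m i) * (\<Prod>i\<in>I - J. \<alpha> i ^ N i)" if "finite J" "J \<subseteq> I" for J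
    using that
  proof induction
    case (insert i J)
    then have i: "i \<in> I" "i \<in> I - J" by auto
    have "I - J - {i} = I - insert i J" by auto
    then have "(\<Prod>i\<in>I - J. \<alpha> i ^ N i) = \<alpha> i ^ N i * (\<Prod>i\<in>I - insert i J. \<alpha> i ^ N i)"
      using i(2) assms(1) by (subst prod.remove[of _ i]) auto
    with insert have "d dvd \<alpha> i ^ N i * ((\<Prod>i\<in>J. \<alpha> i ^ m i) * (\<Prod>i\<in>I - insert i J. \<alpha> i ^ N i))"
      by (simp add: mult_ac)
    from dvd_strip_prime_power[OF assms(2-4)[OF i(1)] this]
    show ?case using insert.hyps by (simp add: mult_ac)
  qed (use assms(5) in simp)
  from this[OF assms(1)] show ?thesis by simp
qed

text \<open>
  Expressing test elements in terms of \<open>F\<close> multiplies the matrix of \<open>F\<close> by the matrix of coefficients.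
\<close>

lemma det_basis_dvd:
  fixes F :: "'n::finite \<Rightarrow> 'n \<Rightarrow> 'a::comm_ring_1"
  assumes "\<And>j. \<exists>c. \<forall>i. f j i = (\<Sum>k\<in>UNIV. F k i * c k)"
  shows "det (\<chi> i j. F j i) dvd det (\<chi> i j. f j i)"
proof -
  from assms obtain c where c: "\<And>i j. f j i = (\<Sum>k\<in>UNIV. F k i * c j k)" by metis
  have "(\<chi> i j. f j i) = (\<chi> i j. F j i) ** (\<chi> k j. c j k)"
    by (simp add: vec_eq_iff matrix_matrix_mult_def c)
  then show ?thesis by (simp add: det_mul)
qed

text \<open>
  One half of Saito's criterion. For every hyperplane \<open>k\<close>, consider the arrangement consisting of this
  hyperplane only. It has an obvious basis with determinant the power of the form of \<open>k\<close> occurring in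
  \<open>Q\<close>; multiplied by the product \<open>R k\<close> of the other factors of \<open>Q\<close>, this basis consists of splines.
  Hence the determinant in question contains the form of \<open>k\<close> at most as often as \<open>Q\<close> does, and it is
  a divisor of a power of \<open>Q\<close>.
\<close>

lemma det_spline_basis_dvd:
  fixes E :: "'n::{finite,linorder} set set" and F :: "'n \<Rightarrow> 'n \<Rightarrow> ('k::field, 'n) pring"
  assumes "simple_graph E" "\<forall>f\<in>splines E \<psi>. \<exists>c. \<forall>i. f i = (\<Sum>j\<in>UNIV. F j i * c j)"
  shows "det (\<chi> i j. F j i) dvd defining_product E \<psi>"
proof -
  let ?I = "hyperplane_indices E" and ?n = "CARD('n)"
  let ?\<alpha> = "\<lambda>k. form k ^ form_multiplicity \<psi> k :: ('k, 'n) pring"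
  define R where "R k = (\<Prod>l\<in>?I - {k}. ?\<alpha> l)" for k
  have \<alpha>_R: "?\<alpha> l dvd R k" if "l \<in> ?I" "l \<noteq> k" for k l
    unfolding R_def using that by (intro form_power_dvd) auto
  have test: "det (\<chi> i j. F j i) dvd ?\<alpha> k * R k ^ ?n" if k: "k \<in> ?I" for k
  proof (cases k)
    case (Inl v)
    define f where "f j i = (if i = j then (if j = v then ?\<alpha> k * R k else R k) else 0)" for i j
    have "f j \<in> splines E \<psi>" for j
    proof (rule splinesI[OF assms(1)])
      show "var i ^ \<psi> i dvd f j i" for i
        using \<alpha>_R[of "Inl i" k] by (auto simp: f_def Inl hyperplane_indices_def)
      fix e assume "e \<in> E"
      then have "form (Inr e) dvd R k" using \<alpha>_R[of "Inr e" k] by (auto simp: Inl hyperplane_indices_def)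
      then show "form (Inr e) dvd f j (Min e) - f j (Max e)"
        by (intro dvd_diff) (auto simp: f_def simp del: form.simps)
    qed
    then have "det (\<chi> i j. F j i) dvd det (\<chi> i j. f j i)"
      using assms(2) by (intro det_basis_dvd) blast
    also have "det (\<chi> i j. f j i) = (\<Prod>j\<in>UNIV. f j j)"
      by (subst det_diagonal) (auto simp: f_def)
    also have "\<dots> = (\<Prod>j\<in>UNIV. (if j = v then ?\<alpha> k else 1) * R k)"
      by (rule prod.cong) (auto simp: f_def)
    also have "\<dots> = ?\<alpha> k * R k ^ ?n"
      unfolding prod.distrib by simp
    finally show ?thesis .
  next
    case (Inr e)
    with k have e: "e \<in> E" by (auto simp: hyperplane_indices_def)
    define a b where ab: "a = Min e" "b = Max e"
    have "a \<noteq> b" "e = {a, b}"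
      using edge_Min_Max[OF assms(1) e] unfolding ab by auto
    define g where "g j i = (if i = j then (if j = b then ?\<alpha> k * R k else R k) else 0)" for i j
    \<comment> \<open>Up to the factor \<open>R k\<close>, the basis for the hyperplane \<open>x\<^sub>a = x\<^sub>b\<close> alone: the unit vectors other
      than those at \<open>a\<close> and \<open>b\<close>, the sum of these two, and \<open>form k\<close> times the one at \<open>b\<close>.\<close>
    define f where "f j i = (if i = b then g j b + g j a else g j i)" for i j
    have R_f: "R k dvd f j i" for i j
      by (auto simp: f_def g_def)
    have "f j \<in> splines E \<psi>" for j
    proof (rule splinesI[OF assms(1)])
      show "var i ^ \<psi> i dvd f j i" for i
        using dvd_trans[OF \<alpha>_R[of "Inl i" k] R_f[of j i]] by (simp add: Inr hyperplane_indices_def)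
      fix e' assume e': "e' \<in> E"
      show "form (Inr e') dvd f j (Min e') - f j (Max e')"
      proof (cases "e' = e")
        case True
        have "f j a - f j b = - g j b"
          using \<open>a \<noteq> b\<close> by (simp add: f_def)
        moreover have "form (Inr e) dvd g j b"
          by (auto simp: g_def Inr)
        ultimately show ?thesis
          unfolding True ab[symmetric] by (simp only: dvd_minus_iff)
      next
        case False
        then have "form (Inr e') dvd R k"
          using \<alpha>_R[of "Inr e'" k] e' by (auto simp: Inr hyperplane_indices_def)
        then show ?thesis by (intro dvd_diff dvd_trans[OF _ R_f])
      qed
    qed
    then have "det (\<chi> i j. F j i) dvd det (\<chi> i j. f j i)"
      using assms(2) by (intro det_basis_dvd) blast
    also have "(\<chi> i j. f j i) = (\<chi> i. if i = b then row b (\<chi> i j. g j i) + 1 *s row a (\<chi> i j. g j i) else row i (\<chi> i j. g j i))"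
      by (auto simp: vec_eq_iff row_def f_def)
    also have "det \<dots> = det (\<chi> i j. g j i)"
      using \<open>a \<noteq> b\<close> by (intro det_row_operation) auto
    also have "\<dots> = (\<Prod>j\<in>UNIV. g j j)"
      by (subst det_diagonal) (auto simp: g_def)
    also have "\<dots> = (\<Prod>j\<in>UNIV. (if j = b then ?\<alpha> k else 1) * R k)"
      by (rule prod.cong) (auto simp: g_def)
    also have "\<dots> = ?\<alpha> k * R k ^ ?n"
      unfolding prod.distrib by simp
    finally show ?thesis .
  qed
  have coprime: "\<not> form k dvd R k ^ ?n" if k: "k \<in> ?I" for k
  proof
    assume "form k dvd R k ^ ?n"
    then have "form k dvd R k" by (rule prime_elem_dvd_power[OF prime_form[OF assms(1) k]])
    then have "form k dvd (\<Prod>l\<in>?I - {k}. ?\<alpha> l)" by (simp add: R_def)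
    from prime_elem_dvd_prod[OF prime_form[OF assms(1) k] _ this]
    obtain l where l: "l \<in> ?I - {k}" "form k dvd ?\<alpha> l" by auto
    from prime_elem_dvd_power[OF prime_form[OF assms(1) k] l(2)] form_not_dvd_form[OF assms(1) k] l(1)
    show False by blast
  qed
  obtain k :: "'n + 'n set" where k: "k \<in> ?I" by (auto simp: hyperplane_indices_def)
  have "?\<alpha> k * R k ^ ?n dvd (?\<alpha> k * R k) ^ ?n"
    unfolding power_mult_distrib by (intro mult_dvd_mono dvd_power) auto
  also have "?\<alpha> k * R k = (\<Prod>l\<in>?I. ?\<alpha> l)"
    unfolding R_def using k by (simp add: prod.remove)
  also have "\<dots> ^ ?n = (\<Prod>l\<in>?I. form l ^ (form_multiplicity \<psi> l * ?n))"
    by (simp add: prod_power_distrib power_mult)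
  finally have "det (\<chi> i j. F j i) dvd (\<Prod>l\<in>?I. form l ^ (form_multiplicity \<psi> l * ?n))"
    using test[OF k] by (rule dvd_trans[rotated])
  from dvd_prod_prime_powers[OF finite_hyperplane_indices prime_form[OF assms(1)] coprime test this]
  show ?thesis
    unfolding defining_product_def by blast
qed

section \<open>Determinants of splines along an induced path\<close>

lemma det_row_add_multiple:
  fixes B :: "'a::comm_ring_1 ^ 'n::finite ^ 'n"
  assumes "u \<noteq> k"
  shows "det (\<chi> v. if v = k then x + c *s B $ u else B $ v) = det (\<chi> v. if v = k then x else B $ v)"
proof -
  have "det (\<chi> v. if v = k then B $ u else B $ v) = 0"
    by (rule det_identical_rows[of k u]) (use assms in \<open>auto simp: row_def\<close>)
  then show ?thesis
    by (simp add: det_row_add det_row_mul)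
qed

lemma det_row_combination:
  fixes A B :: "'a::comm_ring_1 ^ 'n::finite ^ 'n"
  assumes "\<And>v. v \<noteq> k \<Longrightarrow> A $ v = B $ v" "u \<noteq> k" "w \<noteq> k"
    and "A $ k = c *s B $ k + a *s B $ u + b *s B $ w"
  shows "det A = c * det B"
proof -
  have "A = (\<chi> v. if v = k then c *s B $ k + a *s B $ u + b *s B $ w else B $ v)"
    using assms(1,4) by (simp add: vec_eq_iff)
  also have "det \<dots> = det (\<chi> v. if v = k then c *s B $ k else B $ v)"
    by (rule trans[OF det_row_add_multiple[OF assms(3)] det_row_add_multiple[OF assms(2)]])
  also have "\<dots> = c * det (\<chi> v. if v = k then B $ k else B $ v)"
    by (rule det_row_mul)
  also have "(\<chi> v. if v = k then B $ k else B $ v) = B"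
    by (simp add: vec_eq_iff)
  finally show ?thesis .
qed

lemma subst_det:
  fixes A :: "('k::field, 'n::finite) pring ^ 'n ^ 'n"
  shows "subst f (det A) = det (\<chi> i j. subst f (A $ i $ j))"
proof -
  have "subst f (of_int (sign p)) = of_int (sign p)" for p :: "'n \<Rightarrow> 'n"
    by (cases p rule: sign_cases) simp_all
  then show ?thesis by (simp add: det_def)
qed

lemma power2_dvd_det:
  fixes A :: "'a::comm_ring_1 ^ 'n::finite ^ 'n"
  assumes "i \<noteq> k" "\<And>j. s dvd A $ i $ j" "\<And>j. s dvd A $ k $ j"
  shows "s\<^sup>2 dvd det A"
  unfolding det_def
proof (intro dvd_sum dvd_mult)
  fix p :: "'n \<Rightarrow> 'n"
  have "(\<Prod>v\<in>UNIV. A $ v $ p v) = A $ i $ p i * (A $ k $ p k * (\<Prod>v\<in>UNIV - {i} - {k}. A $ v $ p v))"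
    using assms(1) by (simp add: prod.remove[of UNIV i] prod.remove[of "UNIV - {i}" k])
  then show "s\<^sup>2 dvd (\<Prod>v\<in>UNIV. A $ v $ p v)"
    using assms(2,3) by (simp add: power2_eq_square mult_dvd_mono)
qed

text \<open>
  Restriction to the flat on which all variables of the path take the value \<open>t\<close>.
\<close>

definition collapse_path :: "(nat \<Rightarrow> 'n) \<Rightarrow> nat \<Rightarrow> ('k::field, 'n) pring \<Rightarrow> 'n \<Rightarrow> ('k, 'n) pring" where
  "collapse_path p m t v = (if v \<in> p ` {..m} then t else var v)"

text \<open>
  The order of vanishing of \<open>det G\<close> along the flat \<open>y\<^sub>0 = ... = y\<^sub>m = 0\<close>, where \<open>y\<^sub>i = x\<^sub>i - z\<close>. The rows
  of the path in \<open>G\<close> give quotients \<open>k\<^sub>0\<close>, \<open>h\<^sub>i\<close>, \<open>h\<^sub>m\<close> (by \<open>y\<^sub>0\<close> to the power \<open>a\<close>, by \<open>x\<^sub>i - x\<^sub>i\<^sub>+\<^sub>1\<close>, and by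
  \<open>y\<^sub>m\<close> to the power \<open>b\<close>). Telescoping the differences along the path yields a linear relation among
  these \<open>m + 2\<close> quotients. Because \<open>b \<le> a\<close>, subtracting multiples of \<open>k\<^sub>0\<close> from the others removes
  \<open>k\<^sub>0\<close> from the relation, and what is left is a syzygy of \<open>x\<^sub>i - x\<^sub>i\<^sub>+\<^sub>1\<close> (\<open>i < m\<close>) and \<open>y\<^sub>m\<close> to the power
  \<open>b\<close>. This is a regular sequence, so all coefficients \<open>h'\<^sub>i\<close> of the syzygy vanish on the flat.
  
  The rows of \<open>G\<close> on the path are combinations of \<open>k\<^sub>0, h'\<^sub>1, ..., h'\<^sub>m\<close>; the row \<open>h'\<^sub>0\<close> is left out.
  This extracts from \<open>det G\<close> all the expected factors except \<open>x\<^sub>0 - x\<^sub>1\<close>. The remaining determinant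
  divides \<open>(x\<^sub>0 - x\<^sub>1) r\<close> and has at least two rows vanishing on the flat, as \<open>m \<ge> 2\<close>. So it vanishes
  there to order two, and \<open>r\<close> has to vanish there as well.
\<close>

lemma determinant_along_path:
  fixes p :: "nat \<Rightarrow> 'n::{finite,linorder}" and z :: "('k::field, 'n) pring"
    and G :: "('k, 'n) pring ^ 'n::{finite,linorder} ^ 'n::{finite,linorder}"
  assumes m: "2 \<le> m" "inj_on p {..m}" and ab: "1 \<le> b" "b \<le> a"
    and z: "\<And>f. (\<And>v. v \<notin> p ` {..m} \<Longrightarrow> f v = var v) \<Longrightarrow> subst f z = z" "z \<noteq> var (p 0)"
    and first: "\<And>j. (var (p 0) - z) ^ a dvd G $ p 0 $ j"
    and last: "\<And>j. (var (p m) - z) ^ b dvd G $ p m $ j"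
    and steps: "\<And>i j. i < m \<Longrightarrow> var (p i) - var (p (Suc i)) dvd G $ p i $ j - G $ p (Suc i) $ j"
    and dvd: "det G dvd (var (p 0) - z) ^ a * (var (p m) - z) ^ b * (\<Prod>i<m. var (p i) - var (p (Suc i))) * r"
  shows "subst (collapse_path p m z) r = 0"
proof -
  define x where "x i = (var (p i) :: ('k, 'n) pring)" for i
  define y where "y i = x i - z" for i
  have p_eq: "p i = p j \<longleftrightarrow> i = j" if "i \<le> m" "j \<le> m" for i j
    using m(2) that by (auto simp: inj_on_def)
  have y0: "y 0 \<noteq> 0" using z(2) by (simp add: y_def x_def)
  obtain k0 where k0: "\<And>j. G $ p 0 $ j = y 0 ^ a * k0 j"
    using first unfolding dvd_def y_def x_def by metis
  obtain hm where hm: "\<And>j. G $ p m $ j = y m ^ b * hm j"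
    using last unfolding dvd_def y_def x_def by metis
  have "\<forall>i j. \<exists>h. i < m \<longrightarrow> G $ p i $ j - G $ p (Suc i) $ j = (x i - x (Suc i)) * h"
    using steps unfolding dvd_def x_def by blast
  then obtain h where h: "\<And>i j. i < m \<Longrightarrow> G $ p i $ j - G $ p (Suc i) $ j = (x i - x (Suc i)) * h i j"
    by metis
  obtain \<kappa> where \<kappa>: "y 0 ^ b - y m ^ b = (y 0 - y m) * \<kappa>"
    using diff_dvd_power_diff[of "y 0" "y m" b] by (auto elim: dvdE)
  define s where "s = y 0 ^ (a - b)"
  have ya: "y 0 ^ a = s * y 0 ^ b" using ab by (simp add: s_def flip: power_add)
  define h' where "h' i j = (if i < m then h i j - s * \<kappa> * k0 j else hm j - s * k0 j)" for i j
  \<comment> \<open>\<open>y\<^sub>0\<close> to the power \<open>a\<close> is \<open>s * y\<^sub>m ^ b + s * \<kappa> * (y\<^sub>0 - y\<^sub>m)\<close>, and \<open>y\<^sub>0 - y\<^sub>m\<close> is the sum of the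
    \<open>x\<^sub>i - x\<^sub>i\<^sub>+\<^sub>1\<close>; this determines which multiples of \<open>k\<^sub>0\<close> have to be subtracted.\<close>
  have syzygy: "(\<Sum>i<m. (x i - x (Suc i)) * h' i j) + y m ^ b * h' m j = 0" for j
  proof -
    have tele: "(\<Sum>i<m. g i - g (Suc i)) = g 0 - g m" for g :: "nat \<Rightarrow> ('k, 'n) pring"
      by (induction m) auto
    have "(\<Sum>i<m. (x i - x (Suc i)) * h' i j)
        = (\<Sum>i<m. (G $ p i $ j - G $ p (Suc i) $ j) - (x i - x (Suc i)) * (s * \<kappa> * k0 j))"
      by (rule sum.cong) (auto simp: h h'_def algebra_simps)
    also have "\<dots> = (G $ p 0 $ j - G $ p m $ j) - (x 0 - x m) * (s * \<kappa> * k0 j)"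
      by (subst sum_subtractf)
        (simp only: sum_distrib_right[symmetric] tele[of x] tele[of "\<lambda>i. G $ p i $ j"])
    also have "x 0 - x m = y 0 - y m" by (simp add: y_def)
    also have "(y 0 - y m) * (s * \<kappa> * k0 j) = s * (y 0 ^ b - y m ^ b) * k0 j"
      unfolding \<kappa> by (simp add: mult_ac)
    finally show ?thesis
      unfolding k0 hm ya by (simp add: h'_def algebra_simps)
  qed
  \<comment> \<open>Only the variable of \<open>p 0\<close> is kept on the path: along this line through the flat the order of
    vanishing can be read off as the exponent of \<open>y 0\<close>.\<close>
  define \<rho> where "\<rho> v = (if v \<in> p ` {1..m} then z else var v)" for v
  have z_fix: "subst (var(p 0 := z)) z = z" "subst \<rho> z = z"
    by (rule z(1); auto simp: \<rho>_def image_iff)+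
  have \<rho>_collapse: "subst (var(p 0 := z)) (subst \<rho> w) = subst (collapse_path p m z) w" for w
  proof -
    have "{..m} = insert 0 {1..m}" by auto
    then have "subst (var(p 0 := z)) (\<rho> v) = collapse_path p m z v" for v
      using z_fix(1) by (simp add: \<rho>_def collapse_path_def)
    then show ?thesis by (simp add: subst_subst)
  qed
  have to_collapse: "y 0 dvd subst \<rho> w \<longleftrightarrow> subst (collapse_path p m z) w = 0" for w
    unfolding y_def x_def dvd_iff_subst_eq_0[OF z_fix(1)] \<rho>_collapse ..
  have collapse: "subst (collapse_path p m z) w = 0" if "subst \<sigma> w = 0" "\<And>v. subst (var(p 0 := z)) (\<sigma> v) = collapse_path p m z v" for \<sigma> w
  proof -
    have "subst (collapse_path p m z) w = subst (var(p 0 := z)) (subst \<sigma> w)"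
      unfolding subst_subst using that(2) by presburger
    with that(1) show ?thesis by simp
  qed
  \<comment> \<open>Making all variables of the path equal kills every coefficient of the syzygy except the last.\<close>
  have "subst (collapse_path p m z) (h' m j) = 0" for j
  proof (rule collapse)
    let ?\<sigma> = "collapse_path p m (x 0)"
    have \<sigma>x: "subst ?\<sigma> (x i) = x 0" if "i \<le> m" for i
      using that by (auto simp: x_def collapse_path_def)
    have \<sigma>z: "subst ?\<sigma> z = z" by (rule z(1)) (auto simp: collapse_path_def)
    have "0 = subst ?\<sigma> ((\<Sum>i<m. (x i - x (Suc i)) * h' i j) + y m ^ b * h' m j)"
      unfolding syzygy by simp
    also have "\<dots> = y 0 ^ b * subst ?\<sigma> (h' m j)"
      by (simp add: \<sigma>x \<sigma>z y_def)
    finally show "subst ?\<sigma> (h' m j) = 0" using y0 by simp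
    show "subst (var(p 0 := z)) (?\<sigma> v) = collapse_path p m z v" for v
      by (auto simp: collapse_path_def x_def)
  qed
  then have row_m: "y 0 dvd subst \<rho> (h' m j)" for j by (simp add: to_collapse)
  \<comment> \<open>Sending \<open>p m\<close> to \<open>z\<close> and making the other variables equal kills every coefficient of the
    syzygy except the one of index \<open>m - 1\<close>; here \<open>1 \<le> b\<close> is needed.\<close>
  have "subst (collapse_path p m z) (h' (m - 1) j) = 0" for j
  proof (rule collapse)
    define \<sigma> where "\<sigma> v = (if v = p m then z else collapse_path p m (x 0) v)" for v
    have \<sigma>x: "subst \<sigma> (x i) = (if i = m then z else x 0)" if "i \<le> m" for i
      using that p_eq[of i m] by (auto simp: x_def collapse_path_def \<sigma>_def)
    have \<sigma>z: "subst \<sigma> z = z" by (rule z(1)) (auto simp: collapse_path_def \<sigma>_def)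
    have "0 = subst \<sigma> ((\<Sum>i<m. (x i - x (Suc i)) * h' i j) + y m ^ b * h' m j)"
      unfolding syzygy by simp
    also have "\<dots> = (\<Sum>i<m. subst \<sigma> ((x i - x (Suc i)) * h' i j))"
      using ab by (simp add: \<sigma>x \<sigma>z y_def zero_power)
    also have "\<dots> = (\<Sum>i<m. if i = m - 1 then y 0 * subst \<sigma> (h' (m - 1) j) else 0)"
      by (rule sum.cong) (use \<sigma>x in \<open>auto simp: y_def\<close>)
    also have "\<dots> = y 0 * subst \<sigma> (h' (m - 1) j)"
      using m(1) by simp
    finally show "subst \<sigma> (h' (m - 1) j) = 0" using y0 by simp
    show "subst (var(p 0 := z)) (\<sigma> v) = collapse_path p m z v" for v
      using z_fix(1) by (auto simp: collapse_path_def x_def \<sigma>_def)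
  qed
  then have row_m1: "y 0 dvd subst \<rho> (h' (m - 1) j)" for j by (simp add: to_collapse)
  \<comment> \<open>The rows of the path are replaced by the quotients one at a time, starting at \<open>p 0\<close>. When \<open>p i\<close>
    is treated, \<open>p (Suc i)\<close> still carries its original row, which is subtracted.\<close>
  define ix where "ix = the_inv_into {..m} p"
  have ix: "ix (p i) = i" if "i \<le> m" for i
    unfolding ix_def using that by (intro the_inv_into_f_f[OF m(2)]) auto
  define A where "A t = (\<chi> v j. if v = p 0 then k0 j else if v \<in> p ` {1..t} then h' (ix v) j else G $ v $ j)" for t
  have A0: "A t $ p 0 $ j = k0 j" for t j
    by (simp add: A_def)
  have A1: "A t $ p i $ j = h' i j" if "1 \<le> i" "i \<le> t" "t \<le> m" for t i j
    using that p_eq[of i 0] ix[of i] by (auto simp: A_def)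
  have A2: "A t $ p i $ j = G $ p i $ j" if "t < i" "i \<le> m" for t i j
  proof -
    have ne: "p i \<noteq> p l" if "l \<le> t" for l
      using p_eq[of i l] that \<open>t < i\<close> \<open>i \<le> m\<close> by simp
    have "p i \<notin> p ` {1..t}"
    proof
      assume "p i \<in> p ` {1..t}"
      then obtain l where "l \<le> t" "p i = p l" by auto
      with ne show False by blast
    qed
    with ne[of 0] show ?thesis by (simp add: A_def)
  qed
  have det_A: "det G = y 0 ^ a * (\<Prod>i\<in>{1..t}. x i - x (Suc i)) * det (A t)" if "t < m" for t
    using that
  proof (induction t)
    case 0
    have "det G = y 0 ^ a * det (A 0)"
      by (rule det_row_combination[where k = "p 0" and u = "p 1" and w = "p 1" and a = 0 and b = 0])
        (use m(1) p_eq[of 0 1] in \<open>auto simp: A_def vec_eq_iff k0\<close>)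
    then show ?case by simp
  next
    case (Suc t)
    let ?i = "Suc t"
    have "det (A t) = (x ?i - x (Suc ?i)) * det (A ?i)"
    proof (rule det_row_combination[where k = "p ?i" and u = "p (Suc ?i)" and w = "p 0"
          and a = 1 and b = "(x ?i - x (Suc ?i)) * (s * \<kappa>)"])
      show "A t $ v = A ?i $ v" if "v \<noteq> p ?i" for v
        using that by (auto simp: A_def vec_eq_iff atLeastAtMostSuc_conv)
      show "p (Suc ?i) \<noteq> p ?i" "p 0 \<noteq> p ?i" using Suc.prems p_eq by simp_all
      have "A t $ p ?i $ j = (x ?i - x (Suc ?i)) * A ?i $ p ?i $ j + 1 * A ?i $ p (Suc ?i) $ j
          + (x ?i - x (Suc ?i)) * (s * \<kappa>) * A ?i $ p 0 $ j" for j
      proof -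
        have "A t $ p ?i $ j = G $ p ?i $ j" "A ?i $ p (Suc ?i) $ j = G $ p (Suc ?i) $ j"
          "A ?i $ p 0 $ j = k0 j" "A ?i $ p ?i $ j = h' ?i j"
          using Suc.prems by (simp_all add: A0 A1 A2)
        moreover have "h ?i j = h' ?i j + s * \<kappa> * k0 j"
          using Suc.prems by (simp add: h'_def)
        moreover have "G $ p ?i $ j = (x ?i - x (Suc ?i)) * h ?i j + G $ p (Suc ?i) $ j"
          using h[of ?i j] Suc.prems by (simp add: eq_diff_eq flip: h)
        ultimately show ?thesis
          by (simp only: distrib_left mult.assoc mult_1 add_ac)
      qed
      then show "A t $ p ?i = (x ?i - x (Suc ?i)) *s A ?i $ p ?i + 1 *s A ?i $ p (Suc ?i)
          + ((x ?i - x (Suc ?i)) * (s * \<kappa>)) *s A ?i $ p 0"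
        by (simp add: vec_eq_iff)
    qed
    with Suc show ?case by (simp add: atLeastAtMostSuc_conv mult_ac)
  qed
  have "det (A (m - 1)) = y m ^ b * det (A m)"
  proof (rule det_row_combination[where k = "p m" and u = "p 0" and w = "p 0" and a = "y m ^ b * s" and b = 0])
    have m1: "{1..m} = insert m {1..m - 1}" using m(1) by auto
    show "A (m - 1) $ v = A m $ v" if "v \<noteq> p m" for v
    proof -
      have iff: "v \<in> p ` {1..m} \<longleftrightarrow> v \<in> p ` {1..m - 1}"
        using that unfolding m1 by blast
      show ?thesis
        unfolding A_def vec_eq_iff vec_lambda_beta iff by blast
    qed
    show "p 0 \<noteq> p m" "p 0 \<noteq> p m" using m(1) p_eq by simp_all
    have "A (m - 1) $ p m $ j = y m ^ b * A m $ p m $ j + y m ^ b * s * A m $ p 0 $ j + 0 * A m $ p 0 $ j" for j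
    proof -
      have "A (m - 1) $ p m $ j = G $ p m $ j" "A m $ p m $ j = h' m j" "A m $ p 0 $ j = k0 j"
        using m(1) by (simp_all add: A0 A1 A2)
      moreover have "hm j = h' m j + s * k0 j" by (simp add: h'_def)
      ultimately show ?thesis by (simp only: hm distrib_left mult.assoc mult_zero_left add_0_right)
    qed
    then show "A (m - 1) $ p m = (y m ^ b) *s A m $ p m + (y m ^ b * s) *s A m $ p 0 + 0 *s A m $ p 0"
      by (simp add: vec_eq_iff)
  qed
  with det_A[of "m - 1"] m(1) have det_G:
    "det G = y 0 ^ a * y m ^ b * (\<Prod>i\<in>{1..m - 1}. x i - x (Suc i)) * det (A m)"
    by (simp add: mult_ac)
  define c where "c = y 0 ^ a * y m ^ b * (\<Prod>i\<in>{1..m - 1}. x i - x (Suc i))"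
  have "y m \<noteq> 0"
  proof
    assume "y m = 0"
    then have "var (p m) = z" by (simp add: y_def x_def)
    then have "subst (collapse_path p m (var (p 0))) z = var (p 0)" by (auto simp: collapse_path_def simp flip: \<open>var (p m) = z\<close>)
    moreover have "subst (collapse_path p m (var (p 0))) z = z" by (rule z(1)) (auto simp: collapse_path_def)
    ultimately show False using z(2) by simp
  qed
  moreover have "x i - x (Suc i) \<noteq> 0" if "i \<in> {1..m - 1}" for i
  proof -
    have "i \<le> m" "Suc i \<le> m" using that m(1) by auto
    with p_eq[of i "Suc i"] show ?thesis by (simp add: x_def)
  qed
  ultimately have c: "c \<noteq> 0"
    using y0 by (simp add: c_def)
  have "{..<m} = insert 0 {1..m - 1}" using m(1) by auto
  then have "(\<Prod>i<m. x i - x (Suc i)) = (x 0 - x 1) * (\<Prod>i\<in>{1..m - 1}. x i - x (Suc i))"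
    by simp
  then have "c * det (A m) dvd c * ((x 0 - x 1) * r)"
    using dvd unfolding det_G c_def y_def x_def by (simp add: mult_ac)
  then have "det (A m) dvd (x 0 - x 1) * r" using c by simp
  then have "subst \<rho> (det (A m)) dvd subst \<rho> ((x 0 - x 1) * r)" by (rule subst_dvd)
  moreover have "subst \<rho> (x 0 - x 1) = y 0"
  proof -
    have "p 0 \<noteq> p i" if "i \<in> {1..m}" for i using p_eq[of 0 i] that by auto
    then have "p 0 \<notin> p ` {1..m}" by blast
    moreover have "p 1 \<in> p ` {1..m}" using m(1) by auto
    ultimately show ?thesis by (simp add: x_def y_def \<rho>_def)
  qed
  ultimately have "subst \<rho> (det (A m)) dvd y 0 * subst \<rho> r" by simp
  moreover have "(y 0)\<^sup>2 dvd subst \<rho> (det (A m))"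
    unfolding subst_det
  proof (rule power2_dvd_det)
    show "p m \<noteq> p (m - 1)" using m(1) p_eq by simp
    have "A m $ p m $ j = h' m j" "A m $ p (m - 1) $ j = h' (m - 1) j" for j
      using m(1) by (simp_all add: A1)
    then show "y 0 dvd (\<chi> i j. subst \<rho> (A m $ i $ j)) $ p m $ j"
      "y 0 dvd (\<chi> i j. subst \<rho> (A m $ i $ j)) $ p (m - 1) $ j" for j
      using row_m row_m1 by simp_all
  qed
  ultimately have "(y 0)\<^sup>2 dvd y 0 * subst \<rho> r"
    by (blast intro: dvd_trans)
  then have "y 0 * y 0 dvd y 0 * subst \<rho> r"
    by (simp only: power2_eq_square)
  then have "y 0 dvd subst \<rho> r" using y0 by simp
  then show ?thesis by (simp add: to_collapse)
qed

section \<open>Free arrangements have no holes and no valleys\<close>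

definition path_edges :: "(nat \<Rightarrow> 'n) \<Rightarrow> nat \<Rightarrow> 'n set set" where
  "path_edges p m = (\<lambda>i. {p i, p (Suc i)}) ` {..<m}"

lemma prod_path_edges_dvd:
  fixes p :: "nat \<Rightarrow> 'n::{finite,linorder}"
  assumes "inj_on p {..m}"
  shows "(\<Prod>k\<in>Inr ` path_edges p m. form k ^ form_multiplicity \<psi> k)
    dvd (\<Prod>i<m. var (p i) - var (p (Suc i)) :: ('k::field, 'n) pring)"
proof -
  have p_eq: "p i = p j \<longleftrightarrow> i = j" if "i \<le> m" "j \<le> m" for i j
    using assms that by (auto simp: inj_on_def)
  have inj: "inj_on (\<lambda>i. {p i, p (Suc i)}) {..<m}"
    by (rule inj_onI) (auto simp: doubleton_eq_iff p_eq)
  have "(\<Prod>k\<in>Inr ` path_edges p m. form k ^ form_multiplicity \<psi> k)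
      = (\<Prod>i<m. form (Inr {p i, p (Suc i)}) :: ('k, 'n) pring)"
    unfolding path_edges_def image_image
    by (subst prod.reindex) (use inj in \<open>auto simp: inj_on_def simp del: form.simps\<close>)
  also have "\<dots> dvd (\<Prod>i<m. var (p i) - var (p (Suc i)))"
    by (intro prod_dvd_prod form_pair(3)) (simp add: p_eq)
  finally show ?thesis .
qed

lemma path_edge_iff:
  assumes "induced_path E p m" "i \<le> m" "j \<le> m" "{p i, p j} \<in> E"
  shows "{p i, p j} \<in> path_edges p m"
proof -
  from assms have "i = Suc j \<or> j = Suc i" by (simp add: induced_path_def)
  then show ?thesis
  proof
    assume "i = Suc j"
    with assms(2) show ?thesis
      by (auto simp: path_edges_def insert_commute intro: image_eqI[of _ _ j])
  next
    assume "j = Suc i"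
    with assms(3) show ?thesis
      by (auto simp: path_edges_def intro: image_eqI[of _ _ i])
  qed
qed

lemma defining_product_split:
  fixes E :: "'n::{finite,linorder} set set"
  assumes "T \<subseteq> hyperplane_indices E"
  shows "defining_product E \<psi> = (\<Prod>k\<in>T. form k ^ form_multiplicity \<psi> k)
    * (\<Prod>k\<in>hyperplane_indices E - T. form k ^ form_multiplicity \<psi> k :: ('k::field, 'n) pring)"
  unfolding defining_product_def
  by (subst prod.subset_diff[OF assms]) (auto simp: mult.commute)

text \<open>
  On the flat where all variables of the path are zero, the forms that vanish are exactly the
  variables and the edges of the path, because the path is induced. After the common factor
  \<open>x\<^sub>i\<close> to the power \<open>c\<close> has been removed from every row of the path, \<open>determinant_along_path\<close> asserts that
  the product of all other forms vanishes on the flat as well, which is absurd.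
\<close>

lemma no_descending_valley:
  fixes E :: "'n::{finite,linorder} set set"
  assumes "simple_graph E" "free_multiarrangement (psi_graphical E \<psi> :: ('k::field, 'n) multiarrangement)"
    and "valley_path E \<psi> p m c" "\<psi> (p m) \<le> \<psi> (p 0)"
  shows False
proof -
  from spline_basis[OF assms(1,2)] obtain F :: "'n \<Rightarrow> 'n \<Rightarrow> ('k, 'n) pring" where
    F: "\<And>j. F j \<in> splines E \<psi>" "\<forall>f\<in>splines E \<psi>. \<exists>c. \<forall>i. f i = (\<Sum>j\<in>UNIV. F j i * c j)" by blast
  have path: "induced_path E p m" and m: "2 \<le> m" and inj: "inj_on p {..m}"
    and \<psi>: "c < \<psi> (p 0)" "c < \<psi> (p m)" "\<And>i. 0 < i \<Longrightarrow> i < m \<Longrightarrow> \<psi> (p i) = c"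
    using assms(3) by (auto simp: valley_path_def induced_path_def)
  have p_eq: "p i = p j \<longleftrightarrow> i = j" if "i \<le> m" "j \<le> m" for i j
    using inj that by (auto simp: inj_on_def)
  define U where "U = p ` {..m}"
  have edge: "{p i, p (Suc i)} \<in> E" if "i < m" for i
    using path that by (simp add: induced_path_def)
  define a b where "a = \<psi> (p 0) - c" and "b = \<psi> (p m) - c"
  have \<psi>_U: "\<psi> (p i) = c + (if i = 0 then a else 0) + (if i = m then b else 0)" if "i \<le> m" for i
    using that \<psi> m by (cases "i = 0"; cases "i = m") (auto simp: a_def b_def)
  have "\<exists>g. F j v = (if v \<in> U then var v ^ c else 1) * g" for j v
  proof (cases "v \<in> U")
    case True
    then have "c \<le> \<psi> v" using \<psi>_U by (auto simp: U_def)
    then have "var v ^ c dvd F j v"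
      using F(1)[of j] by (auto simp: splines_def intro: power_le_dvd)
    with True show ?thesis by (auto elim: dvdE)
  qed simp
  then obtain g where g: "\<And>j v. F j v = (if v \<in> U then var v ^ c else 1) * g j v" by metis
  define G where "G = (\<chi> v j. g j v)"
  have "(\<chi> v j. F j v) = (\<chi> v. (if v \<in> U then var v ^ c else 1) *s G $ v)"
    by (simp add: vec_eq_iff G_def g)
  then have "det (\<chi> v j. F j v) = (\<Prod>v\<in>UNIV. if v \<in> U then var v ^ c else 1) * det G"
    by (simp add: det_rows_mul)
  also have "(\<Prod>v\<in>UNIV. if v \<in> U then var v ^ c else 1) = (\<Prod>v\<in>U. var v ^ c :: ('k, 'n) pring)"
    by (simp add: prod.If_cases)
  also have "\<dots> = (\<Prod>i\<le>m. var (p i) ^ c)"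
    unfolding U_def by (simp add: prod.reindex[OF inj])
  finally have det_F: "det (\<chi> v j. F j v) = (\<Prod>i\<le>m. var (p i) ^ c) * det G" .
  define T where "T = Inl ` U \<union> Inr ` path_edges p m"
  define out :: "('k, 'n) pring" where "out = (\<Prod>k\<in>hyperplane_indices E - T. form k ^ form_multiplicity \<psi> k)"
  have T: "T \<subseteq> hyperplane_indices E"
    using edge by (auto simp: T_def hyperplane_indices_def path_edges_def)
  have fin: "finite (path_edges p m)" by (simp add: path_edges_def)
  have "defining_product E \<psi> = (\<Prod>k\<in>T. form k ^ form_multiplicity \<psi> k) * out"
    unfolding out_def by (rule defining_product_split[OF T])
  also have "(\<Prod>k\<in>T. form k ^ form_multiplicity \<psi> k)
      = (\<Prod>k\<in>Inl ` U. form k ^ form_multiplicity \<psi> k) * (\<Prod>k\<in>Inr ` path_edges p m. form k ^ form_multiplicity \<psi> k :: ('k, 'n) pring)"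
    unfolding T_def by (rule prod.union_disjoint) (use fin in auto)
  also have "(\<Prod>k\<in>Inl ` U. form k ^ form_multiplicity \<psi> k) = (\<Prod>i\<le>m. var (p i) ^ \<psi> (p i) :: ('k, 'n) pring)"
    by (simp add: prod.reindex U_def inj)
  also have "\<dots> = (\<Prod>i\<le>m. var (p i) ^ c * ((if i = 0 then var (p 0) ^ a else 1) * (if i = m then var (p m) ^ b else 1)))"
    by (rule prod.cong) (auto simp: \<psi>_U power_add)
  also have "\<dots> = (\<Prod>i\<le>m. var (p i) ^ c) * (var (p 0) ^ a * var (p m) ^ b)"
    by (simp add: prod.distrib)
  finally have "defining_product E \<psi> dvd
      (\<Prod>i\<le>m. var (p i) ^ c) * (var (p 0) ^ a * var (p m) ^ b) * (\<Prod>i<m. var (p i) - var (p (Suc i))) * out"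
    using prod_path_edges_dvd[OF inj, of \<psi>] by (auto intro: mult_dvd_mono)
  from dvd_trans[OF det_spline_basis_dvd[OF assms(1) F(2)] this]
  have "(\<Prod>i\<le>m. var (p i) ^ c) * det G dvd
      (\<Prod>i\<le>m. var (p i) ^ c) * (var (p 0) ^ a * var (p m) ^ b * (\<Prod>i<m. var (p i) - var (p (Suc i))) * out)"
    unfolding det_F by (simp only: mult.assoc)
  then have "det G dvd var (p 0) ^ a * var (p m) ^ b * (\<Prod>i<m. var (p i) - var (p (Suc i))) * out"
    by simp
  then have dvd: "det G dvd (var (p 0) - 0) ^ a * (var (p m) - 0) ^ b * (\<Prod>i<m. var (p i) - var (p (Suc i))) * out"
    by simp
  have end_dvd: "var (p i) ^ d dvd G $ p i $ j" if "i \<le> m" "\<psi> (p i) = c + d" for i j d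
  proof -
    have "var (p i) ^ (c + d) dvd F j (p i)"
      using F(1)[of j] that(2)[symmetric] by (simp add: splines_def)
    with that(1) show ?thesis by (simp add: g G_def U_def power_add)
  qed
  have "subst (collapse_path p m 0) out = 0"
  proof (rule determinant_along_path[OF m inj _ _ _ _ _ _ _ dvd])
    show "1 \<le> b" "b \<le> a" using \<psi> assms(4) by (auto simp: a_def b_def)
    show "(var (p 0) - 0) ^ a dvd G $ p 0 $ j" "(var (p m) - 0) ^ b dvd G $ p m $ j" for j
      using end_dvd[of 0 a j] end_dvd[of m b j] \<psi>_U[of 0] \<psi>_U[of m] m by simp_all
    fix i j assume i: "i < m"
    have "var (p i) - var (p (Suc i)) dvd F j (p i) - F j (p (Suc i))"
      using F(1)[of j] edge[OF i] by (auto simp: splines_def)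
    then have "var (p i) - var (p (Suc i)) dvd var (p i) ^ c * g j (p i) - var (p (Suc i)) ^ c * g j (p (Suc i))"
      using i by (simp add: g U_def)
    from edge_dvd_cancel_power[OF _ this] p_eq[of i "Suc i"] i
    show "var (p i) - var (p (Suc i)) dvd G $ p i $ j - G $ p (Suc i) $ j"
      by (simp add: G_def)
  qed simp_all
  moreover have "subst (collapse_path p m 0) (form k) \<noteq> (0 :: ('k, 'n) pring)" if k: "k \<in> hyperplane_indices E - T" for k
  proof (cases k)
    case (Inl v)
    with k have "v \<notin> U" by (auto simp: T_def)
    then show ?thesis by (simp add: Inl collapse_path_def U_def)
  next
    case (Inr e)
    with k have e: "e \<in> E" "e \<notin> path_edges p m" by (auto simp: T_def hyperplane_indices_def)
    note e' = edge_Min_Max[OF assms(1) e(1)]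
    have "\<not> (Min e \<in> U \<and> Max e \<in> U)"
    proof
      assume "Min e \<in> U \<and> Max e \<in> U"
      then obtain i j where ij: "i \<le> m" "j \<le> m" "Min e = p i" "Max e = p j" by (auto simp: U_def)
      with e'(2) e(1) have "{p i, p j} \<in> E" "e = {p i, p j}" by simp_all
      with path_edge_iff[OF path ij(1,2)] e(2) show False by simp
    qed
    then show ?thesis
      using e'(1) by (auto simp: Inr collapse_path_def U_def[symmetric])
  qed
  then have "subst (collapse_path p m 0) out \<noteq> 0"
    by (simp add: out_def)
  ultimately show False by blast
qed

text \<open>
  The path can be reversed, so its first end may be assumed to be the heavier one.
\<close>

lemma no_valley:
  fixes E :: "'n::{finite,linorder} set set"
  assumes "simple_graph E" "free_multiarrangement (psi_graphical E \<psi> :: ('k::field, 'n) multiarrangement)"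
  shows "\<not> valley_path E \<psi> p m c"
proof
  assume v: "valley_path E \<psi> p m c"
  define p' where "p' i = p (m - i)" for i
  have inj: "inj_on p {..m}" and adj: "\<And>i j. i \<le> m \<Longrightarrow> j \<le> m \<Longrightarrow> {p i, p j} \<in> E \<longleftrightarrow> i = Suc j \<or> j = Suc i"
    using v by (auto simp: valley_path_def induced_path_def)
  have "inj_on p' {..m}"
  proof (rule inj_onI)
    fix i j assume "i \<in> {..m}" "j \<in> {..m}" "p' i = p' j"
    then have "m - i = m - j" "i \<le> m" "j \<le> m" using inj_onD[OF inj, of "m - i" "m - j"] by (auto simp: p'_def)
    then show "i = j" by linarith
  qed
  moreover have "{p' i, p' j} \<in> E \<longleftrightarrow> i = Suc j \<or> j = Suc i" if "i \<le> m" "j \<le> m" for i j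
  proof -
    have "{p' i, p' j} \<in> E \<longleftrightarrow> m - i = Suc (m - j) \<or> m - j = Suc (m - i)"
      unfolding p'_def by (rule adj) simp_all
    also have "\<dots> \<longleftrightarrow> i = Suc j \<or> j = Suc i" using that by linarith
    finally show ?thesis .
  qed
  ultimately have "induced_path E p' m" by (simp add: induced_path_def)
  then have "valley_path E \<psi> p' m c"
    using v by (auto simp: valley_path_def p'_def)
  then have "\<not> \<psi> (p' m) \<le> \<psi> (p' 0)"
    using no_descending_valley[OF assms] by blast
  moreover have "\<not> \<psi> (p m) \<le> \<psi> (p 0)"
    using v no_descending_valley[OF assms] by blast
  ultimately show False by (simp add: p'_def)
qed

lemma det_subtract_row:
  fixes M :: "'a::comm_ring_1 ^ 'n::finite ^ 'n"
  assumes "q \<notin> U"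
  shows "det (\<chi> v. if v \<in> U then M $ v - M $ q else M $ v) = det M"
proof -
  have "finite U" by simp
  then show ?thesis using assms
  proof induction
    case empty
    show ?case by simp
  next
    case (insert k U)
    let ?M = "\<lambda>U. \<chi> v. if v \<in> U then M $ v - M $ q else M $ v"
    have "det (?M (insert k U)) = 1 * det (?M U)"
      by (rule det_row_combination[where k = k and u = q and w = q and a = "- 1" and b = 0])
        (use insert in \<open>auto simp: vec_eq_iff\<close>)
    with insert show ?case by simp
  qed
qed

text \<open>
  The flat is the one where all variables of the hole are equal. Subtracting the row of \<open>q\<close> from the
  rows of the path turns the edges at \<open>q\<close> into divisibility conditions at the ends of the path, as for
  a valley with excess weight one at both ends.
\<close>

lemma no_hole:
  fixes E :: "'n::{finite,linorder} set set"
  assumes "simple_graph E" "free_multiarrangement (psi_graphical E \<psi> :: ('k::field, 'n) multiarrangement)"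
  shows "\<not> hole E p m q"
proof
  assume hole: "hole E p m q"
  from spline_basis[OF assms] obtain F :: "'n \<Rightarrow> 'n \<Rightarrow> ('k, 'n) pring" where
    F: "\<And>j. F j \<in> splines E \<psi>" "\<forall>f\<in>splines E \<psi>. \<exists>c. \<forall>i. f i = (\<Sum>j\<in>UNIV. F j i * c j)" by blast
  have path: "induced_path E p m" and m: "2 \<le> m" and inj: "inj_on p {..m}"
    and q: "q \<notin> p ` {..m}" "\<And>i. i \<le> m \<Longrightarrow> {q, p i} \<in> E \<longleftrightarrow> i = 0 \<or> i = m"
    using hole by (auto simp: hole_def induced_path_def)
  have p_eq: "p i = p j \<longleftrightarrow> i = j" if "i \<le> m" "j \<le> m" for i j
    using inj that by (auto simp: inj_on_def)
  have q_neq: "q \<noteq> p i" if "i \<le> m" for i using q(1) that by auto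
  define U where "U = p ` {..m}"
  have edge: "{p i, p (Suc i)} \<in> E" if "i < m" for i
    using path that by (simp add: induced_path_def)
  define M where "M = (\<chi> v j. F j v)"
  define G where "G = (\<chi> v. if v \<in> U then M $ v - M $ q else M $ v)"
  have det_G: "det G = det M"
    unfolding G_def by (rule det_subtract_row) (use q in \<open>simp add: U_def\<close>)
  have G: "G $ p i $ j = F j (p i) - F j q" if "i \<le> m" for i j
    using that by (simp add: G_def U_def M_def)
  define T :: "('n + 'n set) set" where "T = insert (Inr {p 0, q}) (insert (Inr {p m, q}) (Inr ` path_edges p m))"
  define out :: "('k, 'n) pring" where "out = (\<Prod>k\<in>hyperplane_indices E - T. form k ^ form_multiplicity \<psi> k)"
  have q_edges: "{p 0, q} \<in> E" "{p m, q} \<in> E"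
    using q(2)[of 0] q(2)[of m] by (simp_all add: insert_commute)
  have T: "T \<subseteq> hyperplane_indices E"
    using edge q_edges by (auto simp: T_def hyperplane_indices_def path_edges_def)
  have fin: "finite (path_edges p m)" by (simp add: path_edges_def)
  have "q \<notin> e" if "e \<in> path_edges p m" for e
  proof -
    from that obtain i where "i < m" "e = {p i, p (Suc i)}" by (auto simp: path_edges_def)
    then show ?thesis using q_neq[of i] q_neq[of "Suc i"] by simp
  qed
  then have notin: "{p 0, q} \<notin> path_edges p m" "{p m, q} \<notin> path_edges p m" by blast+
  have "{p 0, q} \<noteq> {p m, q}"
    using p_eq[of 0 m] m by (auto simp: doubleton_eq_iff)
  then have prod_T: "(\<Prod>k\<in>T. form k ^ form_multiplicity \<psi> k) = form (Inr {p 0, q}) * (form (Inr {p m, q})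
      * (\<Prod>k\<in>Inr ` path_edges p m. form k ^ form_multiplicity \<psi> k :: ('k, 'n) pring))"
    unfolding T_def using notin fin by (simp add: image_iff del: form.simps)
  have "defining_product E \<psi> dvd
      (var (p 0) - var q) * ((var (p m) - var q) * (\<Prod>i<m. var (p i) - var (p (Suc i)))) * out"
    unfolding defining_product_split[OF T] prod_T out_def[symmetric]
    by (intro mult_dvd_mono form_pair(3) prod_path_edges_dvd[OF inj] dvd_refl) (use q_neq in auto)
  from dvd_trans[OF det_spline_basis_dvd[OF assms(1) F(2)] this]
  have dvd: "det G dvd (var (p 0) - var q) ^ 1 * (var (p m) - var q) ^ 1 * (\<Prod>i<m. var (p i) - var (p (Suc i))) * out"
    unfolding det_G M_def power_one_right by (simp only: mult.assoc)
  have to_q: "var (p i) - var q dvd G $ p i $ j" if "i = 0 \<or> i = m" for i j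
    using F(1)[of j] q_edges that G[of i j] by (auto simp: splines_def)
  have "subst (collapse_path p m (var q)) out = 0"
  proof (rule determinant_along_path[OF m inj _ _ _ _ _ _ _ dvd])
    show "subst f (var q) = var q" if "\<And>v. v \<notin> p ` {..m} \<Longrightarrow> f v = var v" for f :: "'n \<Rightarrow> ('k, 'n) pring"
      using that[OF q(1)] by simp
    show "(var (p 0) - var q) ^ 1 dvd G $ p 0 $ j" "(var (p m) - var q) ^ 1 dvd G $ p m $ j" for j
      using to_q[of 0 j] to_q[of m j] by simp_all
    fix i j assume i: "i < m"
    have "var (p i) - var (p (Suc i)) dvd F j (p i) - F j (p (Suc i))"
      using F(1)[of j] edge[OF i] by (auto simp: splines_def)
    then show "var (p i) - var (p (Suc i)) dvd G $ p i $ j - G $ p (Suc i) $ j"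
      using i by (simp add: G)
  qed (use q_neq[of 0] in auto)
  moreover have "subst (collapse_path p m (var q)) (form k) \<noteq> (0 :: ('k, 'n) pring)" if k: "k \<in> hyperplane_indices E - T" for k
  proof (cases k)
    case (Inl v)
    then show ?thesis by (simp add: collapse_path_def)
  next
    case (Inr e)
    with k have e: "e \<in> E" "e \<notin> path_edges p m" "e \<noteq> {p 0, q}" "e \<noteq> {p m, q}"
      by (auto simp: T_def hyperplane_indices_def)
    note e' = edge_Min_Max[OF assms(1) e(1)]
    have "\<not> (Min e \<in> insert q U \<and> Max e \<in> insert q U)"
    proof
      assume "Min e \<in> insert q U \<and> Max e \<in> insert q U"
      then consider "Min e = q" "Max e = q" | i where "i \<le> m" "e = {p i, q}" 
        | i j where "i \<le> m" "j \<le> m" "e = {p i, p j}"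
        using e'(2) unfolding U_def by (auto simp: insert_commute)
      then show False
      proof cases
        case 1
        with e'(1) show False by simp
      next
        case (2 i)
        then have "i = 0 \<or> i = m" using q(2)[of i] e(1) by (simp add: insert_commute)
        with 2 e(3,4) show False by auto
      next
        case (3 i j)
        with path_edge_iff[OF path 3(1,2)] e(1,2) show False by simp
      qed
    qed
    then show ?thesis
      using e'(1) by (auto simp: Inr collapse_path_def U_def[symmetric])
  qed
  then have "subst (collapse_path p m (var q)) out \<noteq> 0"
    by (simp add: out_def)
  ultimately show False by blast
qed

theorem theorem6p2:
  fixes E :: "'n::{finite,linorder} set set" and \<psi> :: "'n \<Rightarrow> nat"
  assumes "simple_graph E"
  shows "((\<exists>v. weighted_elimination_ordering E \<psi> v) \<longleftrightarrow>
          (\<exists>\<theta> y. log_der_basis (psi_graphical E \<psi> :: ('k::field, 'n) multiarrangement) \<theta> \<and>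
                 coordinates y \<and> lower_triangular (coefficient_matrix y \<theta>))) \<and>
         ((\<exists>\<theta> y. log_der_basis (psi_graphical E \<psi> :: ('k, 'n) multiarrangement) \<theta> \<and>
                 coordinates y \<and> lower_triangular (coefficient_matrix y \<theta>)) \<longleftrightarrow>
          free_multiarrangement (psi_graphical E \<psi> :: ('k, 'n) multiarrangement))"
proof -
  let ?M = "psi_graphical E \<psi> :: ('k, 'n) multiarrangement"
  let ?tri = "\<exists>\<theta> y. log_der_basis ?M \<theta> \<and> coordinates y \<and> lower_triangular (coefficient_matrix y \<theta>)"
  have "?tri" if "weighted_elimination_ordering E \<psi> v" for v
    using triangular_basis[OF assms that] coordinates_axis that
    unfolding weighted_elimination_ordering_def perfect_elimination_ordering_def by blast
  moreover have "free_multiarrangement ?M" if "?tri"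
    using that unfolding log_der_basis_def free_multiarrangement_def by blast
  moreover have "\<exists>v. weighted_elimination_ordering E \<psi> v" if "free_multiarrangement ?M"
    using weighted_elimination_ordering_if_no_obstruction[OF assms]
      no_hole[OF assms that] no_valley[OF assms that] by blast
  ultimately show ?thesis by blast
qed

end
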